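(* Let $G$ be a group. If $\mathrm{cd}_{\mathbb{Q}}G<\infty$ then $\mathrm{cd}_{\mathbb{Q}}G\le\mathrm{Gcd}_{\mathbb{Z}}\,G$.
   Context: $\mathrm{cd}_{\mathbb{Q}}G$ is the minimal length of a resolution of the trivial module $\mathbb{Q}$ by projective $\mathbb{Q}G$-modules. A $\mathbb{Z}G$-module is Gorenstein projective if it is a cokernel in a $\mathbb{Z}$-indexed acyclic complex $T_*$ of projective $\mathbb{Z}G$-modules such that $\mathrm{Hom}_{\mathbb{Z}G}(T_*,Q)$ is acyclic for every projective $\mathbb{Z}G$-module $Q$. $\mathrm{Gcd}_{\mathbb{Z}}\,G\in\mathbb{N}\cup\{\infty\}$ is the minimal length of a resolution of the trivial module $\mathbb{Z}$ by Gorenstein projective $\mathbb{Z}G$-modules. *)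

theory Defs
  imports
    "HOL-Algebra.Module"
    "HOL-Algebra.AbelCoset"
    "HOL-Library.Poly_Mapping"
    "HOL-Library.Extended_Nat"
begin

text \<open>
  A group is a type of class \<^class>\<open>group_add\<close>; this class does not assume commutativity, it
  only writes the operation as \<open>+\<close>. The group ring \<open>kG\<close> is then the type \<open>'g \<Rightarrow>\<^sub>0 'k\<close> of finitely
  supported functions, whose multiplication in \<^theory>\<open>HOL-Library.Poly_Mapping\<close> is
  convolution along the group operation.
\<close>

subsection \<open>Left modules over a not necessarily commutative ring\<close>

text \<open>
  The locale \<open>module\<close> of HOL-Algebra requires a commutative ring. Its record type is reused here;
  the fields \<open>mult\<close> and \<open>one\<close> of that record play no role.
\<close>

locale left_module = abelian_group M
  for M :: "('r::ring_1, 'm) module" (structure) +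
  assumes smult_closed [simp, intro]: "x \<in> carrier M \<Longrightarrow> a \<odot> x \<in> carrier M"
    and smult_l_distr: "x \<in> carrier M \<Longrightarrow> (a + b) \<odot> x = a \<odot> x \<oplus> b \<odot> x"
    and smult_r_distr:
      "x \<in> carrier M \<Longrightarrow> y \<in> carrier M \<Longrightarrow> a \<odot> (x \<oplus> y) = a \<odot> x \<oplus> a \<odot> y"
    and smult_assoc: "x \<in> carrier M \<Longrightarrow> (a * b) \<odot> x = a \<odot> (b \<odot> x)"
    and smult_one [simp]: "x \<in> carrier M \<Longrightarrow> 1 \<odot> x = x"

text \<open>Only the values on the carrier of the source matter; no convention is imposed outside it.\<close>

definition mod_hom :: "('r::ring_1, 'm) module \<Rightarrow> ('r, 'n) module \<Rightarrow> ('m \<Rightarrow> 'n) set" where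
  "mod_hom M N = {h \<in> carrier M \<rightarrow> carrier N.
     (\<forall>x\<in>carrier M. \<forall>y\<in>carrier M. h (x \<oplus>\<^bsub>M\<^esub> y) = h x \<oplus>\<^bsub>N\<^esub> h y) \<and>
     (\<forall>a. \<forall>x\<in>carrier M. h (a \<odot>\<^bsub>M\<^esub> x) = a \<odot>\<^bsub>N\<^esub> h x)}"

text \<open>
  Projectivity is the lifting property against epimorphisms. HOL cannot quantify over all types
  inside a definition, so the epimorphisms tested are those from modules on the type \<open>'m \<Rightarrow> 'r\<close>
  onto modules on \<open>'m\<close>. Since these include the free cover of \<open>P\<close>, nothing is lost: lemma
  \<open>projective_lift\<close> below derives the lifting property for modules on arbitrary types.
\<close>

definition projective :: "('r::ring_1, 'm) module \<Rightarrow> bool" where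
  "projective P \<longleftrightarrow> left_module P \<and>
     (\<forall>(A :: ('r, 'm \<Rightarrow> 'r) module) (B :: ('r, 'm) module).
        left_module A \<longrightarrow> left_module B \<longrightarrow>
        (\<forall>p\<in>mod_hom A B. \<forall>f\<in>mod_hom P B. p ` carrier A = carrier B \<longrightarrow>
           (\<exists>g\<in>mod_hom P A. \<forall>x\<in>carrier P. p (g x) = f x)))"

definition free_cover :: "('r::ring_1, 'm) module \<Rightarrow> ('r, 'm \<Rightarrow> 'r) module" where
  "free_cover P =
     \<lparr>carrier = {a. finite {x. a x \<noteq> 0} \<and> {x. a x \<noteq> 0} \<subseteq> carrier P},
      mult = (\<lambda>a b. a), one = (\<lambda>x. 0), zero = (\<lambda>x. 0), add = (\<lambda>a b x. a x + b x),
      smult = (\<lambda>r a x. r * a x)\<rparr>"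

lemma left_module_free_cover: "left_module (free_cover (P :: ('r::ring_1, 'm) module))"
proof -
  have mem_cover: "a \<in> carrier (free_cover P) \<longleftrightarrow>
      finite {x. a x \<noteq> 0} \<and> {x. a x \<noteq> 0} \<subseteq> carrier P" for a
    by (simp add: free_cover_def)
  have add: "(\<lambda>x. a x + b x) \<in> carrier (free_cover P)"
    if "a \<in> carrier (free_cover P)" "b \<in> carrier (free_cover P)" for a b
  proof -
    have "{x. a x + b x \<noteq> 0} \<subseteq> {x. a x \<noteq> 0} \<union> {x. b x \<noteq> 0}" by auto
    moreover have "finite ({x. a x \<noteq> 0} \<union> {x. b x \<noteq> 0})"
      "{x. a x \<noteq> 0} \<union> {x. b x \<noteq> 0} \<subseteq> carrier P"
      using that by (auto simp: free_cover_def)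
    ultimately show ?thesis
      unfolding mem_cover by (meson finite_subset order_trans)
  qed
  have smult: "(\<lambda>x. r * a x) \<in> carrier (free_cover P)"
    if "a \<in> carrier (free_cover P)" for a r
  proof -
    have "{x. r * a x \<noteq> 0} \<subseteq> {x. a x \<noteq> 0}" by auto
    moreover have "finite {x. a x \<noteq> 0}" "{x. a x \<noteq> 0} \<subseteq> carrier P"
      using that by (auto simp: free_cover_def)
    ultimately show ?thesis
      unfolding mem_cover by (meson finite_subset order_trans)
  qed
  have add_eq: "a \<oplus>\<^bsub>free_cover P\<^esub> b = (\<lambda>x. a x + b x)" for a b
    by (simp add: free_cover_def)
  have smult_eq: "r \<odot>\<^bsub>free_cover P\<^esub> a = (\<lambda>x. r * a x)" for a r
    by (simp add: free_cover_def)
  have zero_eq: "\<zero>\<^bsub>free_cover P\<^esub> = (\<lambda>x. 0)"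
    by (simp add: free_cover_def)
  have ab: "abelian_group (free_cover P)"
  proof (rule abelian_groupI)
    fix a assume a: "a \<in> carrier (free_cover P)"
    show "\<exists>b\<in>carrier (free_cover P). b \<oplus>\<^bsub>free_cover P\<^esub> a = \<zero>\<^bsub>free_cover P\<^esub>"
      by (rule bexI[of _ "\<lambda>x. - a x"]) (use a in \<open>auto simp: free_cover_def\<close>)
  next
    show "\<zero>\<^bsub>free_cover P\<^esub> \<in> carrier (free_cover P)"
      by (simp add: free_cover_def)
  qed (simp_all add: add_eq zero_eq add add_ac)
  interpret abelian_group "free_cover P" by (rule ab)
  show ?thesis
    by unfold_locales (simp_all add: add_eq smult_eq smult algebra_simps)
qed

lemma (in left_module) free_cover_extend:
  fixes P :: "('r, 'p) module"
  assumes t: "t \<in> carrier P \<rightarrow> carrier M"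
  shows "\<exists>h\<in>mod_hom (free_cover P) M.
           \<forall>a\<in>carrier (free_cover P). h a = (\<Oplus>x\<in>{x. a x \<noteq> 0}. a x \<odot> t x)"
proof -
  define h where "h a = (\<Oplus>x\<in>{x. a x \<noteq> 0}. a x \<odot> t x)" for a :: "'p \<Rightarrow> 'r"
  have z0: "0 \<odot> x = \<zero>" if "x \<in> carrier M" for x
    using smult_l_distr[OF that, of 0 0] that by simp
  have s0: "r \<odot> \<zero> = \<zero>" for r
    using smult_r_distr[of \<zero> \<zero> r] smult_closed[of \<zero> r] by simp
  have ext: "h a = (\<Oplus>x\<in>S. a x \<odot> t x)"
    if "finite S" "{x. a x \<noteq> 0} \<subseteq> S" "S \<subseteq> carrier P" for a S
    unfolding h_def
    by (rule add.finprod_mono_neutral_cong_left) (use that t z0 in auto)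
  have sm: "r \<odot> (\<Oplus>x\<in>S. a x \<odot> t x) = (\<Oplus>x\<in>S. (r * a x) \<odot> t x)"
    if "finite S" "S \<subseteq> carrier P" for r S and a :: "'p \<Rightarrow> 'r"
    using that
  proof (induction S)
    case empty
    show ?case by (simp add: s0)
  next
    case (insert y S)
    have ty: "t y \<in> carrier M" and tS: "\<And>x. x \<in> S \<Longrightarrow> t x \<in> carrier M"
      using insert.prems t by auto
    then have "(\<lambda>x. a x \<odot> t x) \<in> S \<rightarrow> carrier M" "(\<lambda>x. (r * a x) \<odot> t x) \<in> S \<rightarrow> carrier M"
      by auto
    then show ?case
      using insert ty by (simp add: smult_r_distr smult_assoc)
  qed
  have "h \<in> mod_hom (free_cover P) M"
    unfolding mod_hom_def
  proof (intro CollectI conjI ballI allI)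
    show "h \<in> carrier (free_cover P) \<rightarrow> carrier M"
      unfolding h_def by (rule Pi_I, rule finsum_closed) (use t in \<open>auto simp: free_cover_def\<close>)
  next
    fix a b assume a: "a \<in> carrier (free_cover P)" and b: "b \<in> carrier (free_cover P)"
    define S where "S = {x. a x \<noteq> 0} \<union> {x. b x \<noteq> 0}"
    have S: "finite S" "S \<subseteq> carrier P" "{x. a x \<noteq> 0} \<subseteq> S" "{x. b x \<noteq> 0} \<subseteq> S"
      "{x. a x + b x \<noteq> 0} \<subseteq> S"
      using a b by (auto simp: S_def free_cover_def)
    have tS: "\<And>x. x \<in> S \<Longrightarrow> t x \<in> carrier M" using S t by auto
    have "h (\<lambda>x. a x + b x) = (\<Oplus>x\<in>S. a x \<odot> t x \<oplus> b x \<odot> t x)"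
      unfolding ext[OF S(1,5,2)]
      by (rule finsum_cong') (use tS in \<open>auto simp: smult_l_distr\<close>)
    also have "\<dots> = h a \<oplus> h b"
      unfolding ext[OF S(1,3,2)] ext[OF S(1,4,2)]
      by (rule finsum_addf) (use tS in auto)
    finally show "h (a \<oplus>\<^bsub>free_cover P\<^esub> b) = h a \<oplus> h b"
      by (simp add: free_cover_def)
  next
    fix r a assume a: "a \<in> carrier (free_cover P)"
    have S: "finite {x. a x \<noteq> 0}" "{x. r * a x \<noteq> 0} \<subseteq> {x. a x \<noteq> 0}"
      "{x. a x \<noteq> 0} \<subseteq> carrier P"
      using a by (auto simp: free_cover_def)
    have "h (\<lambda>x. r * a x) = r \<odot> h a"
      unfolding ext[OF S] by (simp add: h_def sm S)
    then show "h (r \<odot>\<^bsub>free_cover P\<^esub> a) = r \<odot> h a"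
      by (simp add: free_cover_def)
  qed
  then show ?thesis by (rule bexI[rotated]) (simp add: h_def)
qed

lemma projective_lift:
  fixes P :: "('r::ring_1, 'm) module" and A :: "('r, 'a) module" and B :: "('r, 'b) module"
  assumes P: "projective P" and A: "left_module A" and B: "left_module B"
    and p: "p \<in> mod_hom A B" "p ` carrier A = carrier B" and f: "f \<in> mod_hom P B"
  shows "\<exists>g\<in>mod_hom P A. \<forall>x\<in>carrier P. p (g x) = f x"
proof -
  let ?F = "free_cover P"
  interpret P: left_module P using P by (simp add: projective_def)
  interpret A: left_module A by (rule A)
  interpret B: left_module B by (rule B)
  interpret F: left_module ?F by (rule left_module_free_cover)
  define \<delta> :: "'m \<Rightarrow> 'm \<Rightarrow> 'r" where "\<delta> x = (\<lambda>y. if y = x then 1 else 0)" for x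
  have \<delta>: "\<delta> x \<in> carrier ?F" "{y. \<delta> x y \<noteq> 0} = {x}" "\<delta> x x = 1" if "x \<in> carrier P" for x
    using that by (auto simp: \<delta>_def free_cover_def)
  obtain e where e: "e \<in> mod_hom ?F P"
    and e_eq: "\<And>a. a \<in> carrier ?F \<Longrightarrow> e a = (\<Oplus>\<^bsub>P\<^esub>x\<in>{x. a x \<noteq> 0}. a x \<odot>\<^bsub>P\<^esub> x)"
    using P.free_cover_extend[of "\<lambda>x. x" P] by auto
  have e\<delta>: "e (\<delta> x) = x" if "x \<in> carrier P" for x
    using that by (simp add: e_eq \<delta>)
  have surj: "e ` carrier ?F = carrier P"
  proof
    show "e ` carrier ?F \<subseteq> carrier P"
      using e unfolding mod_hom_def by blast
    show "carrier P \<subseteq> e ` carrier ?F"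
      using e\<delta> \<delta>(1) by (metis image_eqI subsetI)
  qed
  have "(\<lambda>x. x) \<in> mod_hom P P" by (simp add: mod_hom_def)
  then obtain s where s: "s \<in> mod_hom P ?F" and es: "\<And>x. x \<in> carrier P \<Longrightarrow> e (s x) = x"
    using P[unfolded projective_def, THEN conjunct2, rule_format,
        OF left_module_free_cover P.left_module_axioms e _ surj, of "\<lambda>x. x"] by blast
  have "\<forall>x\<in>carrier P. \<exists>y\<in>carrier A. p y = f x"
  proof
    fix x assume "x \<in> carrier P"
    then have "f x \<in> p ` carrier A"
      unfolding p(2) using f unfolding mod_hom_def by blast
    then show "\<exists>y\<in>carrier A. p y = f x" by auto
  qed
  then obtain t where t: "\<And>x. x \<in> carrier P \<Longrightarrow> t x \<in> carrier A \<and> p (t x) = f x"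
    by metis
  obtain h where h: "h \<in> mod_hom ?F A"
    and h_eq: "\<And>a. a \<in> carrier ?F \<Longrightarrow> h a = (\<Oplus>\<^bsub>A\<^esub>x\<in>{x. a x \<noteq> 0}. a x \<odot>\<^bsub>A\<^esub> t x)"
    using A.free_cover_extend[of t P] t by blast
  have p0: "p \<zero>\<^bsub>A\<^esub> = \<zero>\<^bsub>B\<^esub>"
  proof -
    have c: "p \<zero>\<^bsub>A\<^esub> \<in> carrier B"
      using p(1) A.zero_closed unfolding mod_hom_def by blast
    have "p (\<zero>\<^bsub>A\<^esub> \<oplus>\<^bsub>A\<^esub> \<zero>\<^bsub>A\<^esub>) = p \<zero>\<^bsub>A\<^esub> \<oplus>\<^bsub>B\<^esub> p \<zero>\<^bsub>A\<^esub>"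
      using p(1) A.zero_closed unfolding mod_hom_def by blast
    with c show ?thesis by simp
  qed
  have f0: "f \<zero>\<^bsub>P\<^esub> = \<zero>\<^bsub>B\<^esub>"
  proof -
    have c: "f \<zero>\<^bsub>P\<^esub> \<in> carrier B"
      using f P.zero_closed unfolding mod_hom_def by blast
    have "f (\<zero>\<^bsub>P\<^esub> \<oplus>\<^bsub>P\<^esub> \<zero>\<^bsub>P\<^esub>) = f \<zero>\<^bsub>P\<^esub> \<oplus>\<^bsub>B\<^esub> f \<zero>\<^bsub>P\<^esub>"
      using f P.zero_closed unfolding mod_hom_def by blast
    with c show ?thesis by simp
  qed
  have sums: "p (\<Oplus>\<^bsub>A\<^esub>x\<in>S. a x \<odot>\<^bsub>A\<^esub> t x) = f (\<Oplus>\<^bsub>P\<^esub>x\<in>S. a x \<odot>\<^bsub>P\<^esub> x)"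
    if "finite S" "S \<subseteq> carrier P" for S and a :: "'m \<Rightarrow> 'r"
    using that
  proof (induction S)
    case empty
    show ?case by (simp add: p0 f0)
  next
    case (insert y S)
    have y: "y \<in> carrier P" "t y \<in> carrier A" "p (t y) = f y" using insert.prems t by auto
    have S1: "(\<lambda>x. a x \<odot>\<^bsub>A\<^esub> t x) \<in> S \<rightarrow> carrier A" using insert.prems t by auto
    have S2: "(\<lambda>x. a x \<odot>\<^bsub>P\<^esub> x) \<in> S \<rightarrow> carrier P" using insert.prems by auto
    show ?case
      using insert y S1 S2 A.finsum_closed[OF S1] P.finsum_closed[OF S2] p(1) f
      by (simp add: mod_hom_def)
  qed
  have phe: "p (h a) = f (e a)" if "a \<in> carrier ?F" for a
    unfolding h_eq[OF that] e_eq[OF that]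
    by (rule sums) (use that in \<open>auto simp: free_cover_def\<close>)
  have sF: "s x \<in> carrier ?F" if "x \<in> carrier P" for x
    using s that unfolding mod_hom_def by blast
  show ?thesis
  proof (intro bexI[of _ "\<lambda>x. h (s x)"] ballI)
    show "(\<lambda>x. h (s x)) \<in> mod_hom P A"
      using h s sF by (simp add: mod_hom_def Pi_iff)
    show "p (h (s x)) = f x" if "x \<in> carrier P" for x
      using phe[OF sF[OF that]] es[OF that] by simp
  qed
qed

subsection \<open>Gorenstein projective modules\<close>

text \<open>
  A complex is a \<open>\<int>\<close>-indexed family with differentials \<open>d n : T n \<rightarrow> T (n - 1)\<close>; exactness
  includes \<open>d n \<circ> d (n + 1) = 0\<close>.
\<close>

definition acyclic_complex ::
  "(int \<Rightarrow> ('r::ring_1, 'm) module) \<Rightarrow> (int \<Rightarrow> 'm \<Rightarrow> 'm) \<Rightarrow> bool" where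
  "acyclic_complex T d \<longleftrightarrow>
     (\<forall>n. left_module (T n)) \<and>
     (\<forall>n. d n \<in> mod_hom (T n) (T (n - 1))) \<and>
     (\<forall>n. a_kernel (T n) (T (n - 1)) (d n) = d (n + 1) ` carrier (T (n + 1)))"

text \<open>
  Exactness of \<open>Hom(T (n-1), Q) \<rightarrow> Hom(T n, Q) \<rightarrow> Hom(T (n+1), Q)\<close> for all \<open>n\<close>.
\<close>

definition Hom_acyclic ::
  "(int \<Rightarrow> ('r::ring_1, 'm) module) \<Rightarrow> (int \<Rightarrow> 'm \<Rightarrow> 'm) \<Rightarrow> ('r, 'm) module \<Rightarrow> bool" where
  "Hom_acyclic T d Q \<longleftrightarrow>
     (\<forall>n. \<forall>f\<in>mod_hom (T n) Q.
        (\<forall>x\<in>carrier (T (n + 1)). f (d (n + 1) x) = \<zero>\<^bsub>Q\<^esub>) \<longleftrightarrow>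
        (\<exists>g\<in>mod_hom (T (n - 1)) Q. \<forall>x\<in>carrier (T n). f x = g (d n x)))"

text \<open>
  \<open>M\<close> is a cokernel in \<open>T\<close> when some epimorphism \<open>p : T n \<rightarrow> M\<close> has the image of \<open>d (n + 1)\<close>
  as its kernel. The modules \<open>T n\<close> and \<open>Q\<close> live on the same type \<open>'m\<close> as \<open>M\<close>. Over \<open>\<int>G\<close> this
  loses nothing: if \<open>M\<close> is nonzero, then a nonzero \<open>\<int>G\<close>-submodule of a free one lives on
  \<open>'m\<close>, so \<open>'m\<close> has cardinality at least \<open>max |G| \<aleph>\<^sub>0\<close>, and projectives on \<open>'m\<close> then suffice
  both for building \<open>T\<close> and for testing it.
\<close>

definition Gorenstein_projective :: "('r::ring_1, 'm) module \<Rightarrow> bool" where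
  "Gorenstein_projective M \<longleftrightarrow> left_module M \<and>
     (\<exists>(T :: int \<Rightarrow> ('r, 'm) module) d.
        acyclic_complex T d \<and> (\<forall>n. projective (T n)) \<and>
        (\<forall>Q :: ('r, 'm) module. projective Q \<longrightarrow> Hom_acyclic T d Q) \<and>
        (\<exists>n. \<exists>p\<in>mod_hom (T n) M.
           p ` carrier (T n) = carrier M \<and>
           a_kernel (T n) M p = d (n + 1) ` carrier (T (n + 1))))"

subsection \<open>Resolutions and dimensions\<close>

text \<open>
  A resolution of \<open>N\<close> of length at most \<open>n\<close> by modules in the class \<open>C\<close>, padded by zero modules
  beyond degree \<open>n\<close>; \<open>d i : P (i + 1) \<rightarrow> P i\<close>, and \<open>e\<close> is the augmentation.
\<close>

definition has_resolution ::
  "(('r::ring_1, 'm) module \<Rightarrow> bool) \<Rightarrow> ('r, 'n) module \<Rightarrow> nat \<Rightarrow> bool" where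
  "has_resolution C N n \<longleftrightarrow>
     (\<exists>(P :: nat \<Rightarrow> ('r, 'm) module) d e.
        (\<forall>i. left_module (P i) \<and> C (P i)) \<and>
        (\<forall>i>n. carrier (P i) = {\<zero>\<^bsub>P i\<^esub>}) \<and>
        (\<forall>i. d i \<in> mod_hom (P (Suc i)) (P i)) \<and>
        e \<in> mod_hom (P 0) N \<and>
        e ` carrier (P 0) = carrier N \<and>
        a_kernel (P 0) N e = d 0 ` carrier (P 1) \<and>
        (\<forall>i. a_kernel (P (Suc i)) (P i) (d i) = d (Suc i) ` carrier (P (Suc (Suc i)))))"

text \<open>The infimum of the empty set is \<open>\<infinity>\<close>.\<close>

definition resolution_dim ::
  "(('r::ring_1, 'm) module \<Rightarrow> bool) \<Rightarrow> ('r, 'n) module \<Rightarrow> enat" where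
  "resolution_dim C N = Inf (enat ` {n. has_resolution C N n})"

definition augmentation :: "('g \<Rightarrow>\<^sub>0 'k::comm_ring_1) \<Rightarrow> 'k" where
  "augmentation a = (\<Sum>g\<in>Poly_Mapping.keys a. Poly_Mapping.lookup a g)"

definition trivial_module :: "('g::group_add \<Rightarrow>\<^sub>0 'k::comm_ring_1, 'k) module" where
  "trivial_module =
     \<lparr>carrier = UNIV, mult = (*), one = 1, zero = 0, add = (+),
      smult = (\<lambda>a x. augmentation a * x)\<rparr>"

text \<open>
  The second type argument of the following two dimensions is the type on which the modules of
  the resolutions live. A type that is too small can only make the dimension \<open>\<infinity>\<close>: as soon as
  a nonzero projective \<open>\<rat>G\<close>-module (respectively \<open>\<int>G\<close>-module) lives on \<open>'m\<close>, the type \<open>'m\<close> has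
  cardinality at least \<open>max |G| \<aleph>\<^sub>0\<close>, and then resolutions on \<open>'m\<close> attain the minimal length
  over all modules.
\<close>

definition cd_Q :: "'g::group_add itself \<Rightarrow> 'm itself \<Rightarrow> enat" where
  "cd_Q G U = resolution_dim (projective :: ('g \<Rightarrow>\<^sub>0 rat, 'm) module \<Rightarrow> bool)
     (trivial_module :: ('g \<Rightarrow>\<^sub>0 rat, rat) module)"

definition Gcd_Z :: "'g::group_add itself \<Rightarrow> 'm itself \<Rightarrow> enat" where
  "Gcd_Z G U = resolution_dim (Gorenstein_projective :: ('g \<Rightarrow>\<^sub>0 int, 'm) module \<Rightarrow> bool)
     (trivial_module :: ('g \<Rightarrow>\<^sub>0 int, int) module)"

end

theory Submission
  imports Defs
begin

text \<open>
  Let \<open>P\<close> be a projective resolution of \<open>\<rat>\<close> over \<open>\<rat>G\<close> of length \<open>k + 1\<close>, let \<open>M\<close> be a Gorenstein projective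
  resolution of \<open>\<int>\<close> over \<open>\<int>G\<close> of length \<open>m \<le> k\<close>, and let \<open>F\<close> be a free \<open>\<rat>G\<close>-module containing the top
  term of \<open>P\<close> as a summand. Instead of tensor products, consider the groups \<open>B(P\<^sub>i, Y)\<close> of biadditive
  \<open>G\<close>-equivariant maps \<open>P\<^sub>i \<times> Y \<rightarrow> F\<close>. They are exact in \<open>Y\<close>, because \<open>P\<^sub>i\<close> is projective and \<open>F\<close> is a
  rational vector space, and \<open>B(P, T)\<close> is exact in positive degrees if \<open>T\<close> is projective over \<open>\<int>G\<close>.

  If \<open>Y\<close> is a cokernel in an acyclic complex of projectives, then \<open>H\<^sup>i B(P, Y)\<close> embeds into
  \<open>H\<^sup>i\<^sup>+\<^sup>1 B(P, Y')\<close> for the next cokernel \<open>Y'\<close>; as \<open>P\<close> has finite length, iterating gives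
  \<open>H\<^sup>i B(P, Y) = 0\<close> for \<open>i > 0\<close>. (So only the acyclicity of the complete resolution matters: over a
  group with \<open>cd\<^sub>\<rat> G < \<infinity>\<close> a Gorenstein projective module is rationally projective.) The double complex
  \<open>B(P, M)\<close> now shows that a cocycle on \<open>P\<close> with values in \<open>F\<close> in degree \<open>k + 1 > m\<close> is a coboundary.
  Applied to the inclusion of the top term into \<open>F\<close> this splits the first differential, and \<open>P\<close> can be
  shortened.
\<close>

subsection \<open>Additive maps into rational vector spaces\<close>

lemma mod_homD:
  assumes "h \<in> mod_hom M N"
  shows "x \<in> carrier M \<Longrightarrow> h x \<in> carrier N"
    and "x \<in> carrier M \<Longrightarrow> y \<in> carrier M \<Longrightarrow> h (x \<oplus>\<^bsub>M\<^esub> y) = h x \<oplus>\<^bsub>N\<^esub> h y"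
    and "x \<in> carrier M \<Longrightarrow> h (a \<odot>\<^bsub>M\<^esub> x) = a \<odot>\<^bsub>N\<^esub> h x"
  using assms by (auto simp: mod_hom_def)

context left_module
begin

lemma smult_zero_left [simp]: "x \<in> carrier M \<Longrightarrow> 0 \<odot> x = \<zero>"
  using smult_l_distr[of x 0 0] by simp

lemma smult_zero_right [simp]: "a \<odot> \<zero> = \<zero>"
  using smult_r_distr[of \<zero> \<zero> a] smult_closed[of \<zero> a] by simp

lemma smult_minus_one: "x \<in> carrier M \<Longrightarrow> (- 1) \<odot> x = \<ominus> x"
  using smult_l_distr[of x "-1" 1] by (simp add: minus_equality)

lemma smult_comm_int:
  "x \<in> carrier M \<Longrightarrow> a \<odot> (of_int n \<odot> x) = of_int n \<odot> (a \<odot> x)"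
  by (simp flip: smult_assoc add: mult_of_int_commute)

end

lemma mod_hom_zero:
  assumes "left_module M" "left_module N" "h \<in> mod_hom M N"
  shows "h \<zero>\<^bsub>M\<^esub> = \<zero>\<^bsub>N\<^esub>"
proof -
  interpret M: left_module M by fact
  interpret N: left_module N by fact
  have "h (0 \<odot>\<^bsub>M\<^esub> \<zero>\<^bsub>M\<^esub>) = 0 \<odot>\<^bsub>N\<^esub> h \<zero>\<^bsub>M\<^esub>"
    using assms(3) M.zero_closed by (rule mod_homD(3))
  then show ?thesis
    using mod_homD(1)[OF assms(3) M.zero_closed] by simp
qed

text \<open>The values lie in a whole type of class \<open>ab_group_add\<close>, so sums and
  rational multiples of values need no carrier; only the source is a module record.\<close>

definition additive_on :: "('r, 'a) module \<Rightarrow> ('a \<Rightarrow> 'f::ab_group_add) \<Rightarrow> bool" where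
  "additive_on M h \<longleftrightarrow> (\<forall>x\<in>carrier M. \<forall>y\<in>carrier M. h (x \<oplus>\<^bsub>M\<^esub> y) = h x + h y)"

lemma additive_onD:
  "additive_on M h \<Longrightarrow> x \<in> carrier M \<Longrightarrow> y \<in> carrier M \<Longrightarrow> h (x \<oplus>\<^bsub>M\<^esub> y) = h x + h y"
  by (simp add: additive_on_def)

context left_module
begin

lemma additive_on_zero: "additive_on M h \<Longrightarrow> h \<zero> = 0"
  using additive_onD[of M h \<zero> \<zero>] by simp

lemma additive_on_uminus:
  assumes "additive_on M h" "x \<in> carrier M" shows "h (\<ominus> x) = - h x"
  using additive_onD[OF assms(1), of "\<ominus> x" x] assms
  by (simp add: l_neg additive_on_zero eq_neg_iff_add_eq_0)

lemma additive_on_finsum: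
  assumes "additive_on M h" "finite S" "t \<in> S \<rightarrow> carrier M"
  shows "h (\<Oplus>x\<in>S. t x) = (\<Sum>x\<in>S. h (t x))"
  using assms(2,3)
proof (induction S)
  case empty
  show ?case by (simp add: additive_on_zero assms(1))
next
  case (insert x S)
  then have "t x \<in> carrier M" "t \<in> S \<rightarrow> carrier M" by auto
  with insert show ?case
    by (simp add: additive_onD[OF assms(1)])
qed

lemma additive_on_of_nat:
  assumes "vector_space scale" "additive_on M h" "x \<in> carrier M"
  shows "h (of_nat n \<odot> x) = scale (of_nat n :: rat) (h x)"
proof -
  interpret vector_space scale by fact
  show ?thesis
  proof (induction n)
    case 0
    show ?case by (simp add: additive_on_zero assms)
  next
    case (Suc n)
    then show ?case
      using assms by (simp add: smult_l_distr additive_onD[OF assms(2)] scale_left_distrib)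
  qed
qed

lemma additive_on_of_int:
  assumes "vector_space scale" "additive_on M h" "x \<in> carrier M"
  shows "h (of_int n \<odot> x) = scale (of_int n :: rat) (h x)"
proof -
  interpret vector_space scale by fact
  show ?thesis
  proof (cases n)
    case (nonneg m)
    then show ?thesis using additive_on_of_nat[OF assms, of m] by simp
  next
    case (neg m)
    have "of_int n \<odot> x = (-1) \<odot> (of_nat (Suc m) \<odot> x)"
      using assms(3) unfolding neg by (simp flip: smult_assoc)
    then have "of_int n \<odot> x = \<ominus> (of_nat (Suc m) \<odot> x)"
      using assms(3) by (simp add: smult_minus_one del: of_nat_Suc)
    then show ?thesis
      unfolding neg using additive_on_of_nat[OF assms, of "Suc m"] assms(3)
      by (simp add: additive_on_uminus[OF assms(2)] del: of_nat_Suc)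
  qed
qed

end

text \<open>
  Zorn's lemma is applied to graphs \<open>G\<close> of partial additive maps. The scalars come from \<open>\<int>\<close> only, as
  \<open>D\<close> may be a \<open>\<int>G\<close>-module.
\<close>

locale additive_relation = left_module D + vector_space scale
  for D :: "('r::ring_1, 'd) module" (structure)
    and scale :: "rat \<Rightarrow> 'f::ab_group_add \<Rightarrow> 'f" +
  fixes G :: "('d \<times> 'f) set"
  assumes dom: "(x, v) \<in> G \<Longrightarrow> x \<in> carrier D"
    and add_mem: "(x, v) \<in> G \<Longrightarrow> (y, w) \<in> G \<Longrightarrow> (x \<oplus> y, v + w) \<in> G"
    and mult_mem: "(x, v) \<in> G \<Longrightarrow> (of_int n \<odot> x, scale (of_int n) v) \<in> G"
    and single_valued: "(\<zero>, v) \<in> G \<Longrightarrow> v = 0"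
    and nonempty: "G \<noteq> {}"
begin

lemma zero_mem: "(\<zero>, 0) \<in> G"
proof -
  obtain x v where "(x, v) \<in> G" using nonempty by auto
  from mult_mem[OF this, of 0] dom[OF this] show ?thesis by simp
qed

text \<open>Subtracting two pairs with the same first entry reduces uniqueness everywhere to
  uniqueness at \<open>\<zero>\<close>.\<close>

lemma functional:
  assumes "(x, v) \<in> G" "(x, w) \<in> G"
  shows "v = w"
proof -
  have "(x \<oplus> of_int (-1) \<odot> x, v + scale (of_int (-1)) w) \<in> G"
    using assms by (intro add_mem mult_mem)
  then show ?thesis
    using single_valued[of "v - w"] dom[OF assms(1)] by (simp add: smult_minus_one r_neg)
qed

text \<open>The values admit division by integers: if a nonzero multiple n x already has the value
  w, then x must receive w / n; if no nonzero multiple of x is in the domain, the value 0 will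
  do.\<close>

lemma extend_one:
  assumes x: "x \<in> carrier D"
  obtains G' where "additive_relation D scale G'" "G \<subseteq> G'" "x \<in> Domain G'"
proof -
  have "\<exists>y. \<forall>n w. (of_int n \<odot> x, w) \<in> G \<longrightarrow> w = scale (of_int n) y"
  proof (cases "\<exists>n w. n \<noteq> 0 \<and> (of_int n \<odot> x, w) \<in> G")
    case True
    then obtain n w where n: "n \<noteq> 0" and w: "(of_int n \<odot> x, w) \<in> G" by blast
    have "v = scale (of_int m) (scale (1 / of_int n) w)" if v: "(of_int m \<odot> x, v) \<in> G" for m v
    proof -
      have "(of_int n \<odot> (of_int m \<odot> x), scale (of_int n) v) \<in> G"
        and "(of_int m \<odot> (of_int n \<odot> x), scale (of_int m) w) \<in> G"
        by (rule mult_mem, fact)+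
      then have "scale (of_int n) v = scale (of_int m) w"
        unfolding smult_comm_int[OF x, of "of_int m"] by (rule functional)
      then have "scale (1 / of_int n) (scale (of_int n) v) = scale (1 / of_int n) (scale (of_int m) w)"
        by simp
      then show ?thesis using n by (simp add: mult.commute)
    qed
    then show ?thesis by blast
  next
    case False
    have "w = scale (of_int n) 0" if "(of_int n \<odot> x, w) \<in> G" for n w
      using False that single_valued x by (cases "n = 0") auto
    then show ?thesis by blast
  qed
  then obtain y where y: "\<And>n w. (of_int n \<odot> x, w) \<in> G \<Longrightarrow> w = scale (of_int n) y" by blast
  define G' where "G' = {(a \<oplus> of_int n \<odot> x, v + scale (of_int n) y) | a v n. (a, v) \<in> G}"
  have memI: "(a \<oplus> of_int n \<odot> x, v + scale (of_int n) y) \<in> G'" if "(a, v) \<in> G" for a v n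
    using that by (auto simp: G'_def)
  show thesis
  proof
    show "G \<subseteq> G'"
    proof
      fix z assume "z \<in> G"
      then show "z \<in> G'" using memI[of "fst z" "snd z" 0] x dom[of "fst z" "snd z"] by simp
    qed
    show "x \<in> Domain G'"
      using memI[OF zero_mem, of 1] x by (auto simp: Domain_iff)
    show "additive_relation D scale G'"
    proof unfold_locales
      show "G' \<noteq> {}" using memI[OF zero_mem] by blast
    next
      fix b v assume "(b, v) \<in> G'"
      then show "b \<in> carrier D" using dom x by (auto simp: G'_def)
    next
      fix b v c w assume "(b, v) \<in> G'" "(c, w) \<in> G'"
      then obtain a u n a' u' n' where *: "(a, u) \<in> G" "(a', u') \<in> G"
        and b: "b = a \<oplus> of_int n \<odot> x" "v = u + scale (of_int n) y"
        and c: "c = a' \<oplus> of_int n' \<odot> x" "w = u' + scale (of_int n') y"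
        by (auto simp: G'_def)
      have "b \<oplus> c = (a \<oplus> a') \<oplus> of_int (n + n') \<odot> x"
        using *[THEN dom] x by (simp add: b c smult_l_distr a_ac)
      moreover have "v + w = (u + u') + scale (of_int (n + n')) y"
        by (simp add: b c scale_left_distrib)
      ultimately show "(b \<oplus> c, v + w) \<in> G'"
        using memI[OF add_mem[OF *]] by metis
    next
      fix b v m assume "(b, v) \<in> G'"
      then obtain a u n where *: "(a, u) \<in> G"
        and b: "b = a \<oplus> of_int n \<odot> x" "v = u + scale (of_int n) y"
        by (auto simp: G'_def)
      have "of_int m \<odot> b = of_int m \<odot> a \<oplus> of_int (m * n) \<odot> x"
        using dom[OF *] x by (simp add: b smult_r_distr smult_assoc)
      moreover have "scale (of_int m) v = scale (of_int m) u + scale (of_int (m * n)) y"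
        by (simp add: b scale_right_distrib)
      ultimately show "(of_int m \<odot> b, scale (of_int m) v) \<in> G'"
        using memI[OF mult_mem[OF *]] by metis
    next
      fix v assume "(\<zero>, v) \<in> G'"
      then obtain a u n where *: "(a, u) \<in> G"
        and b: "\<zero> = a \<oplus> of_int n \<odot> x" "v = u + scale (of_int n) y"
        by (auto simp: G'_def)
      \<comment> \<open>Here n x = -a already lies in the domain of \<open>G\<close> with value -u,
        so the choice of \<open>y\<close> gives -u = n y.\<close>
      have "of_int (-1) \<odot> a = of_int n \<odot> x"
        using b(1) dom[OF *] x by (simp add: smult_minus_one minus_equality a_comm)
      then have "(of_int n \<odot> x, scale (of_int (-1)) u) \<in> G"
        using mult_mem[OF *, of "-1"] by simp
      from y[OF this] have "- u = scale (of_int n) y" by simp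
      then show "v = 0" using b(2) by (metis add.right_inverse)
    qed
  qed
qed

end

text \<open>Rational vector spaces are injective abelian groups. The map \<open>i\<close> may have a
  kernel; \<open>h\<close> kills it and therefore descends to the image of \<open>i\<close>, from
  which Zorn's lemma extends it.\<close>

lemma additive_extension:
  fixes C :: "('r::ring_1, 'c) module" and D :: "('r, 'd) module"
    and scale :: "rat \<Rightarrow> 'f::ab_group_add \<Rightarrow> 'f" and h :: "'c \<Rightarrow> 'f"
  assumes vs: "vector_space scale" and C: "left_module C" and D: "left_module D"
    and i: "i \<in> mod_hom C D" and h: "additive_on C h"
    and ker: "\<And>c. c \<in> carrier C \<Longrightarrow> i c = \<zero>\<^bsub>D\<^esub> \<Longrightarrow> h c = 0"
  shows "\<exists>h'. additive_on D h' \<and> (\<forall>c\<in>carrier C. h' (i c) = h c)"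
proof -
  interpret vector_space scale by fact
  interpret C: left_module C by fact
  interpret D: left_module D by fact
  note ih = mod_homD[OF i]
  \<comment> \<open>The graph of the map that \<open>h\<close> induces on the image of
    \<open>i\<close>; single-valuedness at zero is exactly \<open>ker\<close>.\<close>
  let ?G0 = "(\<lambda>c. (i c, h c)) ` carrier C"
  have G0: "additive_relation D scale ?G0"
  proof unfold_locales
    show "?G0 \<noteq> {}" using C.zero_closed by blast
    show "x \<in> carrier D" if "(x, v) \<in> ?G0" for x v using that ih by auto
    show "v = 0" if "(\<zero>\<^bsub>D\<^esub>, v) \<in> ?G0" for v using that ker by auto
    show "(x \<oplus>\<^bsub>D\<^esub> y, v + w) \<in> ?G0" if xy: "(x, v) \<in> ?G0" "(y, w) \<in> ?G0" for x v y w
    proof -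
      obtain c c' where "c \<in> carrier C" "c' \<in> carrier C" "x = i c" "v = h c" "y = i c'" "w = h c'"
        using xy by blast
      then show ?thesis
        by (intro image_eqI[of _ _ "c \<oplus>\<^bsub>C\<^esub> c'"]) (simp_all add: additive_onD[OF h] ih(2))
    qed
    show "(of_int n \<odot>\<^bsub>D\<^esub> x, scale (of_int n) v) \<in> ?G0" if xv: "(x, v) \<in> ?G0" for x v n
    proof -
      obtain c where "c \<in> carrier C" "x = i c" "v = h c" using xv by blast
      then show ?thesis
        by (intro image_eqI[of _ _ "of_int n \<odot>\<^bsub>C\<^esub> c"])
          (simp_all add: C.additive_on_of_int[OF vs h] ih(3))
    qed
  qed
  define A where "A = {G. additive_relation D scale G \<and> ?G0 \<subseteq> G}"
  have "\<exists>M\<in>A. \<forall>X\<in>A. M \<subseteq> X \<longrightarrow> X = M"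
  proof (rule subset_Zorn_nonempty)
    show "A \<noteq> {}" using G0 by (auto simp: A_def)
    fix \<C> assume ne: "\<C> \<noteq> {}" and ch: "subset.chain A \<C>"
    have rel: "additive_relation D scale X" if "X \<in> \<C>" for X
      using that ch by (auto simp: A_def subset.chain_def)
    have "?G0 \<subseteq> \<Union>\<C>"
    proof -
      obtain X where X: "X \<in> \<C>" using ne by blast
      then have "?G0 \<subseteq> X" using ch unfolding A_def subset.chain_def by blast
      with X show ?thesis by blast
    qed
    moreover have "additive_relation D scale (\<Union>\<C>)"
    proof unfold_locales
      show "\<Union>\<C> \<noteq> {}" using calculation C.zero_closed by blast
      show "x \<in> carrier D" if "(x, v) \<in> \<Union>\<C>" for x v
        using that rel[THEN additive_relation.dom] by blast
      show "v = 0" if "(\<zero>\<^bsub>D\<^esub>, v) \<in> \<Union>\<C>" for v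
        using that rel[THEN additive_relation.single_valued] by blast
      show "(of_int n \<odot>\<^bsub>D\<^esub> x, scale (of_int n) v) \<in> \<Union>\<C>" if "(x, v) \<in> \<Union>\<C>" for x v n
        using that rel[THEN additive_relation.mult_mem] by blast
      show "(x \<oplus>\<^bsub>D\<^esub> y, v + w) \<in> \<Union>\<C>" if xy: "(x, v) \<in> \<Union>\<C>" "(y, w) \<in> \<Union>\<C>" for x v y w
      proof -
        obtain X Y where X: "X \<in> \<C>" "(x, v) \<in> X" and Y: "Y \<in> \<C>" "(y, w) \<in> Y" using xy by blast
        then have "X \<subseteq> Y \<or> Y \<subseteq> X" using ch by (auto simp: subset.chain_def)
        then obtain Z where "Z \<in> \<C>" "(x, v) \<in> Z" "(y, w) \<in> Z" using X Y by blast
        then show ?thesis using rel[THEN additive_relation.add_mem] by blast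
      qed
    qed
    ultimately show "\<Union>\<C> \<in> A" by (simp add: A_def)
  qed
  then obtain G where G: "additive_relation D scale G" "?G0 \<subseteq> G"
    and max: "\<And>X. additive_relation D scale X \<Longrightarrow> G \<subseteq> X \<Longrightarrow> X = G"
    by (auto simp: A_def)
  interpret G: additive_relation D scale G by (rule G(1))
  \<comment> \<open>A maximal relation is defined everywhere, since \<open>extend_one\<close> would
    enlarge it otherwise.\<close>
  have total: "\<exists>v. (x, v) \<in> G" if x: "x \<in> carrier D" for x
  proof -
    obtain G' where "additive_relation D scale G'" "G \<subseteq> G'" "x \<in> Domain G'"
      using G.extend_one[OF x] .
    then show ?thesis using max[of G'] by (simp add: Domain_iff)
  qed
  define h' where "h' x = (THE v. (x, v) \<in> G)" for x
  have h'I: "h' x = v" if "(x, v) \<in> G" for x v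
    unfolding h'_def by (rule the_equality) (use that G.functional in blast)+
  have h'G: "(x, h' x) \<in> G" if "x \<in> carrier D" for x
    using total[OF that] h'I by blast
  show ?thesis
  proof (intro exI conjI ballI)
    show "additive_on D h'"
      unfolding additive_on_def by (intro ballI h'I G.add_mem h'G)
    show "h' (i c) = h c" if "c \<in> carrier C" for c
      using G(2) that by (intro h'I) blast
  qed
qed

section \<open>The action of group elements, and projectives as retracts of free modules\<close>

definition gact :: "('g::group_add \<Rightarrow>\<^sub>0 'k::comm_ring_1, 'a) module \<Rightarrow> 'g \<Rightarrow> 'a \<Rightarrow> 'a" where
  "gact M g x = Poly_Mapping.single g 1 \<odot>\<^bsub>M\<^esub> x"

lemma gact_closed:
  "left_module M \<Longrightarrow> x \<in> carrier M \<Longrightarrow> gact M g x \<in> carrier M"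
  by (simp add: gact_def left_module.smult_closed)

lemma gact_add:
  "left_module M \<Longrightarrow> x \<in> carrier M \<Longrightarrow> gact M (g + h) x = gact M g (gact M h x)"
  by (simp add: gact_def mult_single flip: left_module.smult_assoc)

lemma gact_zero:
  "left_module M \<Longrightarrow> x \<in> carrier M \<Longrightarrow> gact M 0 x = x"
  by (simp add: gact_def left_module.smult_one)

lemma gact_distrib:
  "left_module M \<Longrightarrow> x \<in> carrier M \<Longrightarrow> y \<in> carrier M \<Longrightarrow>
    gact M g (x \<oplus>\<^bsub>M\<^esub> y) = gact M g x \<oplus>\<^bsub>M\<^esub> gact M g y"
  by (simp add: gact_def left_module.smult_r_distr)

lemma mod_hom_gact:
  "h \<in> mod_hom M N \<Longrightarrow> x \<in> carrier M \<Longrightarrow> h (gact M g x) = gact N g (h x)"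
  by (simp add: gact_def mod_homD)

text \<open>A finitely supported function is a finite sum of monomials, so additive statements about
  the group ring reduce to monomials.\<close>

lemma poly_mapping_add_induct [case_names zero single add]:
  assumes "P 0" "\<And>g q. P (Poly_Mapping.single g q)" "\<And>a b. P a \<Longrightarrow> P b \<Longrightarrow> P (a + b)"
  shows "P (a :: 'g \<Rightarrow>\<^sub>0 'k::monoid_add)"
proof (induction a rule: update_induct)
  case const
  show ?case by (rule assms(1))
next
  case (update f a b)
  then have "Poly_Mapping.update a b f = f + Poly_Mapping.single a b"
    by (intro poly_mapping_eqI)
      (auto simp: lookup_update lookup_add lookup_single when_def in_keys_iff)
  with update assms show ?case by simp
qed

text \<open>The section comes from lifting the identity of \<open>P\<close> along the canonical
  epimorphism. The formula for \<open>e\<close> is kept so that an element can be rebuilt from its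
  coordinates.\<close>

lemma projective_retract_free_cover:
  fixes P :: "('r::ring_1, 'm) module"
  assumes P: "projective P"
  shows "\<exists>s\<in>mod_hom P (free_cover P). \<exists>e\<in>mod_hom (free_cover P) P.
    (\<forall>a\<in>carrier (free_cover P). e a = (\<Oplus>\<^bsub>P\<^esub>x\<in>{x. a x \<noteq> 0}. a x \<odot>\<^bsub>P\<^esub> x)) \<and>
    (\<forall>x\<in>carrier P. e (s x) = x)"
proof -
  interpret P: left_module P using P by (simp add: projective_def)
  obtain e where e: "e \<in> mod_hom (free_cover P) P"
    and e_eq: "\<And>a. a \<in> carrier (free_cover P) \<Longrightarrow> e a = (\<Oplus>\<^bsub>P\<^esub>x\<in>{x. a x \<noteq> 0}. a x \<odot>\<^bsub>P\<^esub> x)"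
    using P.free_cover_extend[of "\<lambda>x. x" P] by auto
  have "e ` carrier (free_cover P) = carrier P"
  proof
    show "e ` carrier (free_cover P) \<subseteq> carrier P"
      using mod_homD(1)[OF e] by blast
    show "carrier P \<subseteq> e ` carrier (free_cover P)"
    proof
      fix x assume x: "x \<in> carrier P"
      define a :: "'m \<Rightarrow> 'r" where "a = (\<lambda>y. if y = x then 1 else 0)"
      have "a \<in> carrier (free_cover P)" "{y. a y \<noteq> 0} = {x}" "a x = 1"
        using x by (auto simp: a_def free_cover_def)
      then show "x \<in> e ` carrier (free_cover P)"
        using x by (intro image_eqI[of _ _ a]) (simp_all add: e_eq)
    qed
  qed
  moreover have "(\<lambda>x. x) \<in> mod_hom P P" by (simp add: mod_hom_def)
  ultimately have "\<exists>s\<in>mod_hom P (free_cover P). \<forall>x\<in>carrier P. e (s x) = x"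
    by (rule projective_lift[OF P left_module_free_cover P.left_module_axioms e])
  then obtain s where "s \<in> mod_hom P (free_cover P)" "\<And>x. x \<in> carrier P \<Longrightarrow> e (s x) = x"
    by blast
  with e e_eq show ?thesis by blast
qed

subsection \<open>Equivariant biadditive maps\<close>

text \<open>The coefficients of the cohomology: a rational vector space with linear
  \<open>G\<close>-action, on a whole type.\<close>

locale rational_rep = vector_space scale
  for scale :: "rat \<Rightarrow> 'f::ab_group_add \<Rightarrow> 'f" +
  fixes act :: "'g::group_add \<Rightarrow> 'f \<Rightarrow> 'f"
  assumes act_add: "act g (v + w) = act g v + act g w"
    and act_scale: "act g (scale q v) = scale q (act g v)"
    and act_plus: "act (g + h) v = act g (act h v)"
begin

lemma act_0 [simp]: "act g 0 = 0"
  using act_add[of g 0 0] by simp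

lemma act_sum: "act g (sum f S) = (\<Sum>x\<in>S. act g (f x))"
  by (induction S rule: infinite_finite_induct) (simp_all add: act_add)

text \<open>
  \<open>X\<close> and \<open>Y\<close> may be modules over group rings with different coefficients: only their addition and
  the action of \<open>G\<close> enter.
\<close>

definition bil :: "('g \<Rightarrow>\<^sub>0 'k::comm_ring_1, 'a) module \<Rightarrow> ('g \<Rightarrow>\<^sub>0 'l::comm_ring_1, 'b) module
    \<Rightarrow> ('a \<Rightarrow> 'b \<Rightarrow> 'f) set" where
  "bil X Y = {\<beta>. (\<forall>x\<in>carrier X. additive_on Y (\<beta> x)) \<and>
     (\<forall>y\<in>carrier Y. additive_on X (\<lambda>x. \<beta> x y)) \<and>
     (\<forall>g. \<forall>x\<in>carrier X. \<forall>y\<in>carrier Y. \<beta> (gact X g x) (gact Y g y) = act g (\<beta> x y))}"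

lemma bilD:
  assumes "\<beta> \<in> bil X Y"
  shows "x \<in> carrier X \<Longrightarrow> additive_on Y (\<beta> x)"
    and "y \<in> carrier Y \<Longrightarrow> additive_on X (\<lambda>x. \<beta> x y)"
    and "x \<in> carrier X \<Longrightarrow> y \<in> carrier Y \<Longrightarrow> \<beta> (gact X g x) (gact Y g y) = act g (\<beta> x y)"
  using assms by (auto simp: bil_def)

lemma bil_flip: "\<beta> \<in> bil X Y \<Longrightarrow> (\<lambda>y x. \<beta> x y) \<in> bil Y X"
  by (simp add: bil_def)

lemma bil_diff: "\<beta> \<in> bil X Y \<Longrightarrow> \<gamma> \<in> bil X Y \<Longrightarrow> (\<lambda>x y. \<beta> x y - \<gamma> x y) \<in> bil X Y"
proof -
  have "act g (v - w) = act g v - act g w" for g v w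
    using act_add[of g "v - w" w] by simp
  then show "\<beta> \<in> bil X Y \<Longrightarrow> \<gamma> \<in> bil X Y \<Longrightarrow> ?thesis"
    by (simp add: bil_def additive_on_def)
qed

lemma bil_comp:
  assumes "\<beta> \<in> bil X Y" "h \<in> mod_hom X' X" "k \<in> mod_hom Y' Y"
  shows "(\<lambda>x y. \<beta> (h x) (k y)) \<in> bil X' Y'"
  using bilD[OF assms(1)] mod_homD[OF assms(2)] mod_homD[OF assms(3)]
    mod_hom_gact[OF assms(2)] mod_hom_gact[OF assms(3)]
  by (simp add: bil_def additive_on_def)

lemma bil_comp_left:
  "\<beta> \<in> bil X Y \<Longrightarrow> h \<in> mod_hom X' X \<Longrightarrow> (\<lambda>x y. \<beta> (h x) y) \<in> bil X' Y"
  by (erule bil_comp[where k = "\<lambda>y. y"]) (simp_all add: mod_hom_def)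

lemma bil_comp_right:
  "\<beta> \<in> bil X Y \<Longrightarrow> k \<in> mod_hom Y' Y \<Longrightarrow> (\<lambda>x y. \<beta> x (k y)) \<in> bil X Y'"
  by (erule bil_comp[where h = "\<lambda>x. x"]) (simp_all add: mod_hom_def)

section \<open>Extending equivariant biadditive maps when one variable is projective\<close>

text \<open>Clear the denominator of q = a / b: from b (q x) = a x follows b h(q x) = a h(x), and b
  is invertible on the values.\<close>

lemma additive_on_rat:
  fixes M :: "('g \<Rightarrow>\<^sub>0 rat, 'a) module"
  assumes M: "left_module M" and h: "additive_on M h" and x: "x \<in> carrier M"
  shows "h (Poly_Mapping.single 0 q \<odot>\<^bsub>M\<^esub> x) = scale q (h x)"
proof -
  interpret left_module M by fact
  obtain a b where q: "q = of_int a / of_int b" and b: "b > 0"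
    by (rule quotient_of_div[of q "fst (quotient_of q)" "snd (quotient_of q)", THEN that])
      (simp_all add: quotient_of_denom_pos')
  have "of_int b * Poly_Mapping.single 0 q = (of_int a :: 'g \<Rightarrow>\<^sub>0 rat)"
    using b by (simp add: q mult_single flip: single_of_int)
  then have "of_int b \<odot>\<^bsub>M\<^esub> (Poly_Mapping.single 0 q \<odot>\<^bsub>M\<^esub> x) = of_int a \<odot>\<^bsub>M\<^esub> x"
    using x by (simp flip: smult_assoc)
  then have "scale (of_int b) (h (Poly_Mapping.single 0 q \<odot>\<^bsub>M\<^esub> x)) = scale (of_int a) (h x)"
    using additive_on_of_int[OF vector_space_axioms h, of "Poly_Mapping.single 0 q \<odot>\<^bsub>M\<^esub> x" b]
      additive_on_of_int[OF vector_space_axioms h x, of a] x by simp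
  then have "scale (1 / of_int b) (scale (of_int b) (h (Poly_Mapping.single 0 q \<odot>\<^bsub>M\<^esub> x)))
      = scale (1 / of_int b) (scale (of_int a) (h x))" by simp
  then show ?thesis using b by (simp add: q)
qed

text \<open>
  The action of \<open>a \<in> kG\<close> on \<open>\<gamma>\<close> for the conjugation action of \<open>G\<close> on the additive maps from \<open>D\<close>; the
  coefficients act through \<open>\<kappa>\<close>, which is the inclusion of \<open>\<int>\<close> or the identity of \<open>\<rat>\<close>.
\<close>

definition translates ::
    "('k::comm_ring_1 \<Rightarrow> rat) \<Rightarrow> ('g \<Rightarrow>\<^sub>0 'l::comm_ring_1, 'd) module \<Rightarrow> ('g \<Rightarrow>\<^sub>0 'k) \<Rightarrow> ('d \<Rightarrow> 'f) \<Rightarrow> 'd \<Rightarrow> 'f"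
  where "translates \<kappa> D a \<gamma> d =
    (\<Sum>g\<in>Poly_Mapping.keys a. scale (\<kappa> (Poly_Mapping.lookup a g)) (act g (\<gamma> (gact D (- g) d))))"

context
  fixes \<kappa> :: "'k::comm_ring_1 \<Rightarrow> rat"
  assumes \<kappa>_add: "\<kappa> (a + b) = \<kappa> a + \<kappa> b"
begin

lemma \<kappa>_0: "\<kappa> 0 = 0"
  using \<kappa>_add[of 0 0] by simp

lemma translates_add: "translates \<kappa> D (a + b) \<gamma> d = translates \<kappa> D a \<gamma> d + translates \<kappa> D b \<gamma> d"
  unfolding translates_def
  by (rule setsum_keys_plus_distrib) (simp_all add: \<kappa>_0 \<kappa>_add scale_left_distrib)

lemma translates_0: "translates \<kappa> D 0 \<gamma> d = 0"
  by (simp add: translates_def)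

lemma translates_single:
  "translates \<kappa> D (Poly_Mapping.single g q) \<gamma> d = scale (\<kappa> q) (act g (\<gamma> (gact D (- g) d)))"
  by (cases "q = 0") (simp_all add: translates_def \<kappa>_0)

lemma additive_on_translates:
  assumes "left_module D" "additive_on D \<gamma>"
  shows "additive_on D (translates \<kappa> D a \<gamma>)"
  unfolding additive_on_def
proof (intro ballI)
  fix x y assume "x \<in> carrier D" "y \<in> carrier D"
  then show "translates \<kappa> D a \<gamma> (x \<oplus>\<^bsub>D\<^esub> y) = translates \<kappa> D a \<gamma> x + translates \<kappa> D a \<gamma> y"
    by (simp add: translates_def gact_distrib gact_closed assms(1) additive_onD[OF assms(2)]
        act_add scale_right_distrib sum.distrib)
qed

text \<open>On a monomial at g, the inverse of h + g undoes the action of h on \<open>d\<close>,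
  leaving \<open>act h\<close> outside. This yields the equivariance of the extension in
  \<open>bil_extend\<close>.\<close>

lemma translates_gact:
  assumes D: "left_module D" and d: "d \<in> carrier D"
  shows "translates \<kappa> D (Poly_Mapping.single h 1 * a) \<gamma> (gact D h d) = act h (translates \<kappa> D a \<gamma> d)"
proof (induction a rule: poly_mapping_add_induct)
  case zero
  show ?case by (simp add: translates_0)
next
  case (single g q)
  have "gact D (- (h + g)) (gact D h d) = gact D (- g) d"
    using d by (simp add: minus_add flip: gact_add[OF D])
  then show ?case
    by (simp add: mult_single translates_single act_plus act_scale)
next
  case (add a b)
  then show ?case by (simp add: translates_add distrib_left act_add)
qed

text \<open>By equivariance, acting with g on \<beta>(x, -g c) gives \<beta>(g x, c), and
  \<open>lin\<close> moves the coefficient inside; hence on the image of \<open>i\<close> the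
  translates agree with the module action on \<open>x\<close>.\<close>

lemma translates_bil:
  fixes R :: "('g \<Rightarrow>\<^sub>0 'k, 'a) module"
  assumes R: "left_module R" and C: "left_module C" and i: "i \<in> mod_hom C D"
    and \<beta>: "\<beta> \<in> bil R C"
    and lin: "\<And>q x c. x \<in> carrier R \<Longrightarrow> c \<in> carrier C \<Longrightarrow>
      \<beta> (Poly_Mapping.single 0 q \<odot>\<^bsub>R\<^esub> x) c = scale (\<kappa> q) (\<beta> x c)"
    and x: "x \<in> carrier R" and \<gamma>: "\<And>c. c \<in> carrier C \<Longrightarrow> \<gamma> (i c) = \<beta> x c"
    and c: "c \<in> carrier C"
  shows "translates \<kappa> D a \<gamma> (i c) = \<beta> (a \<odot>\<^bsub>R\<^esub> x) c"
proof (induction a rule: poly_mapping_add_induct)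
  case zero
  show ?case
    using x by (simp add: translates_0 left_module.smult_zero_left[OF R]
        left_module.additive_on_zero[OF R bilD(2)[OF \<beta> c]])
next
  case (single g q)
  have "\<beta> (gact R g x) (gact C g (gact C (- g) c)) = act g (\<beta> x (gact C (- g) c))"
    by (rule bilD(3)[OF \<beta> x gact_closed[OF C c]])
  then have "act g (\<beta> x (gact C (- g) c)) = \<beta> (gact R g x) c"
    by (simp add: gact_zero[OF C c] flip: gact_add[OF C c])
  moreover have "Poly_Mapping.single g q \<odot>\<^bsub>R\<^esub> x = Poly_Mapping.single 0 q \<odot>\<^bsub>R\<^esub> gact R g x"
    using x by (simp add: gact_def mult_single flip: left_module.smult_assoc[OF R])
  ultimately show ?case
    by (simp add: translates_single \<gamma> gact_closed[OF C c] lin gact_closed[OF R x] c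
        flip: mod_hom_gact[OF i c])
next
  case (add a b)
  then show ?case
    using additive_onD[OF bilD(2)[OF \<beta> c]] x
    by (simp add: translates_add left_module.smult_l_distr[OF R] left_module.smult_closed[OF R])
qed

text \<open>
  \<open>R\<close> is a retract of the free module on its own carrier, so it suffices to extend \<open>\<beta> x\<close> additively for
  each basis element \<open>x\<close> and to translate.
\<close>

lemma bil_extend:
  fixes R :: "('g \<Rightarrow>\<^sub>0 'k, 'a) module" and C :: "('g \<Rightarrow>\<^sub>0 'l::comm_ring_1, 'c) module"
    and D :: "('g \<Rightarrow>\<^sub>0 'l, 'd) module"
  assumes R: "projective R" and C: "left_module C" and D: "left_module D"
    and i: "i \<in> mod_hom C D" and \<beta>: "\<beta> \<in> bil R C"
    and lin: "\<And>q x c. x \<in> carrier R \<Longrightarrow> c \<in> carrier C \<Longrightarrow>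
      \<beta> (Poly_Mapping.single 0 q \<odot>\<^bsub>R\<^esub> x) c = scale (\<kappa> q) (\<beta> x c)"
    and ker: "\<And>x c. x \<in> carrier R \<Longrightarrow> c \<in> carrier C \<Longrightarrow> i c = \<zero>\<^bsub>D\<^esub> \<Longrightarrow> \<beta> x c = 0"
  shows "\<exists>\<beta>'\<in>bil R D. \<forall>x\<in>carrier R. \<forall>c\<in>carrier C. \<beta>' x (i c) = \<beta> x c"
proof -
  interpret R: left_module R using R by (simp add: projective_def)
  let ?F = "free_cover R"
  obtain s e where s: "s \<in> mod_hom R ?F" and e: "e \<in> mod_hom ?F R"
    and e_eq: "\<And>a. a \<in> carrier ?F \<Longrightarrow> e a = (\<Oplus>\<^bsub>R\<^esub>x\<in>{x. a x \<noteq> 0}. a x \<odot>\<^bsub>R\<^esub> x)"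
    and es: "\<And>x. x \<in> carrier R \<Longrightarrow> e (s x) = x"
    using projective_retract_free_cover[OF R] by blast
  have "\<exists>h. additive_on D h \<and> (\<forall>c\<in>carrier C. h (i c) = \<beta> x c)" if x: "x \<in> carrier R" for x
    by (rule additive_extension[OF vector_space_axioms C D i bilD(1)[OF \<beta> x] ker[OF x]])
  then obtain \<gamma> where \<gamma>: "\<And>x. x \<in> carrier R \<Longrightarrow> additive_on D (\<gamma> x)"
    "\<And>x c. x \<in> carrier R \<Longrightarrow> c \<in> carrier C \<Longrightarrow> \<gamma> x (i c) = \<beta> x c"
    by metis
  have supp: "finite {x. s r x \<noteq> 0}" "{x. s r x \<noteq> 0} \<subseteq> carrier R" if "r \<in> carrier R" for r
    using mod_homD(1)[OF s that] by (auto simp: free_cover_def)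
  \<comment> \<open>The values of \<open>s r\<close> are the coordinates of \<open>r\<close> in the
    free cover; each basis element \<open>x\<close> contributes \<gamma> x translated by its
    coordinate.\<close>
  define \<beta>' where "\<beta>' r d = (\<Sum>x\<in>{x. s r x \<noteq> 0}. translates \<kappa> D (s r x) (\<gamma> x) d)" for r d
  \<comment> \<open>A larger index set allows the supports of different elements to be compared in
    one sum.\<close>
  have \<beta>'_eq: "\<beta>' r d = (\<Sum>x\<in>S. translates \<kappa> D (s r x) (\<gamma> x) d)"
    if "finite S" "{x. s r x \<noteq> 0} \<subseteq> S" for r d S
    unfolding \<beta>'_def by (rule sum.mono_neutral_left) (use that in \<open>auto simp: translates_0\<close>)
  show ?thesis
  proof (intro bexI ballI)
    show "\<beta>' \<in> bil R D"
      unfolding bil_def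
    proof (intro CollectI conjI ballI allI)
      fix r assume r: "r \<in> carrier R"
      show "additive_on D (\<beta>' r)"
        unfolding additive_on_def
      proof (intro ballI)
        fix d d' assume "d \<in> carrier D" "d' \<in> carrier D"
        then show "\<beta>' r (d \<oplus>\<^bsub>D\<^esub> d') = \<beta>' r d + \<beta>' r d'"
          unfolding \<beta>'_def sum.distrib[symmetric] using supp(2)[OF r]
          by (intro sum.cong refl additive_onD additive_on_translates D \<gamma>) auto
      qed
    next
      fix d assume d: "d \<in> carrier D"
      show "additive_on R (\<lambda>r. \<beta>' r d)"
        unfolding additive_on_def
      proof (intro ballI)
        fix r r' assume r: "r \<in> carrier R" "r' \<in> carrier R"
        let ?S = "{x. s r x \<noteq> 0} \<union> {x. s r' x \<noteq> 0}"
        have sr: "s (r \<oplus>\<^bsub>R\<^esub> r') = (\<lambda>x. s r x + s r' x)"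
          using mod_homD(2)[OF s r] by (simp add: free_cover_def)
        have fin: "finite ?S" using r supp by simp
        have "\<beta>' (r \<oplus>\<^bsub>R\<^esub> r') d = (\<Sum>x\<in>?S. translates \<kappa> D (s r x + s r' x) (\<gamma> x) d)"
          by (subst \<beta>'_eq[OF fin]) (auto simp: sr)
        also have "\<dots> = \<beta>' r d + \<beta>' r' d"
          by (simp add: \<beta>'_eq[OF fin Un_upper1] \<beta>'_eq[OF fin Un_upper2] translates_add sum.distrib)
        finally show "\<beta>' (r \<oplus>\<^bsub>R\<^esub> r') d = \<beta>' r d + \<beta>' r' d" .
      qed
    next
      fix g r d assume r: "r \<in> carrier R" and d: "d \<in> carrier D"
      have sr: "s (gact R g r) = (\<lambda>x. Poly_Mapping.single g 1 * s r x)"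
        using mod_homD(3)[OF s r] by (simp add: gact_def free_cover_def)
      have "\<beta>' (gact R g r) (gact D g d)
          = (\<Sum>x\<in>{x. s r x \<noteq> 0}. translates \<kappa> D (Poly_Mapping.single g 1 * s r x) (\<gamma> x) (gact D g d))"
        by (subst \<beta>'_eq[OF supp(1)[OF r]]) (auto simp: sr)
      also have "\<dots> = act g (\<beta>' r d)"
        by (simp add: translates_gact[OF D d] \<beta>'_def act_sum)
      finally show "\<beta>' (gact R g r) (gact D g d) = act g (\<beta>' r d)" .
    qed
    show "\<beta>' r (i c) = \<beta> r c" if r: "r \<in> carrier R" and c: "c \<in> carrier C" for r c
    proof -
      \<comment> \<open>After the translates are absorbed into \<beta>, the coordinates sum up to e
        (s r) = r.\<close>
      have "\<beta>' r (i c) = (\<Sum>x\<in>{x. s r x \<noteq> 0}. \<beta> (s r x \<odot>\<^bsub>R\<^esub> x) c)"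
        unfolding \<beta>'_def
      proof (rule sum.cong)
        fix x assume "x \<in> {x. s r x \<noteq> 0}"
        then have x: "x \<in> carrier R" using supp(2)[OF r] by blast
        show "translates \<kappa> D (s r x) (\<gamma> x) (i c) = \<beta> (s r x \<odot>\<^bsub>R\<^esub> x) c"
          by (rule translates_bil[OF R.left_module_axioms C i \<beta> lin x \<gamma>(2)[OF x] c])
      qed simp
      also have "\<dots> = \<beta> (\<Oplus>\<^bsub>R\<^esub>x\<in>{x. s r x \<noteq> 0}. s r x \<odot>\<^bsub>R\<^esub> x) c"
        using supp[OF r] by (intro R.additive_on_finsum[symmetric] bilD(2)[OF \<beta> c]) auto
      also have "\<dots> = \<beta> r c"
        using e_eq[OF mod_homD(1)[OF s r]] es[OF r] by simp
      finally show ?thesis .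
    qed
  qed
qed

end

text \<open>Exactness in the second variable. Compatibility with rational coefficients is automatic
  by \<open>additive_on_rat\<close>, so \<kappa> is the identity.\<close>

lemma bil_extend_rat:
  fixes R :: "('g \<Rightarrow>\<^sub>0 rat, 'a) module" and C :: "('g \<Rightarrow>\<^sub>0 'l::comm_ring_1, 'c) module"
    and D :: "('g \<Rightarrow>\<^sub>0 'l, 'd) module"
  assumes R: "projective R" and C: "left_module C" and D: "left_module D"
    and i: "i \<in> mod_hom C D" and \<beta>: "\<beta> \<in> bil R C"
    and ker: "\<And>x c. x \<in> carrier R \<Longrightarrow> c \<in> carrier C \<Longrightarrow> i c = \<zero>\<^bsub>D\<^esub> \<Longrightarrow> \<beta> x c = 0"
  shows "\<exists>\<beta>'\<in>bil R D. \<forall>x\<in>carrier R. \<forall>c\<in>carrier C. \<beta>' x (i c) = \<beta> x c"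
proof (rule bil_extend[of "\<lambda>q. q", OF _ R C D i \<beta> _ ker])
  fix q x c assume "x \<in> carrier R" "c \<in> carrier C"
  then show "\<beta> (Poly_Mapping.single 0 q \<odot>\<^bsub>R\<^esub> x) c = scale q (\<beta> x c)"
    using additive_on_rat[of R "\<lambda>x. \<beta> x c"] bilD(2)[OF \<beta>] R by (simp add: projective_def)
qed auto

text \<open>Exactness in the first variable when the second is projective over the integral group
  ring: exchange the variables and take \<kappa> = \<open>of_int\<close>.\<close>

lemma bil_extend_int:
  fixes R :: "('g \<Rightarrow>\<^sub>0 int, 'a) module" and C :: "('g \<Rightarrow>\<^sub>0 'l::comm_ring_1, 'c) module"
    and D :: "('g \<Rightarrow>\<^sub>0 'l, 'd) module"
  assumes R: "projective R" and C: "left_module C" and D: "left_module D"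
    and i: "i \<in> mod_hom C D" and \<beta>: "\<beta> \<in> bil C R"
    and ker: "\<And>x c. x \<in> carrier R \<Longrightarrow> c \<in> carrier C \<Longrightarrow> i c = \<zero>\<^bsub>D\<^esub> \<Longrightarrow> \<beta> c x = 0"
  shows "\<exists>\<beta>'\<in>bil D R. \<forall>c\<in>carrier C. \<forall>x\<in>carrier R. \<beta>' (i c) x = \<beta> c x"
proof -
  have "\<exists>\<beta>'\<in>bil R D. \<forall>x\<in>carrier R. \<forall>c\<in>carrier C. \<beta>' x (i c) = \<beta> c x"
  proof (rule bil_extend[of "of_int", OF _ R C D i bil_flip[OF \<beta>] _ ker])
    fix q x c assume "x \<in> carrier R" "c \<in> carrier C"
    then show "\<beta> c (Poly_Mapping.single 0 q \<odot>\<^bsub>R\<^esub> x) = scale (of_int q) (\<beta> c x)"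
      using left_module.additive_on_of_int[of R scale "\<beta> c" x q] vector_space_axioms bilD(1)[OF \<beta>] R
      by (simp add: projective_def flip: single_of_int)
  qed auto
  then obtain \<beta>' where "\<beta>' \<in> bil R D"
    and "\<forall>x\<in>carrier R. \<forall>c\<in>carrier C. \<beta>' x (i c) = \<beta> c x" by blast
  then show ?thesis by (intro bexI[OF _ bil_flip[of \<beta>']]) auto
qed

end

lemma (in rational_rep) bil_0: "(\<lambda>x y. 0) \<in> bil X Y"
  by (simp add: bil_def additive_on_def)

lemma (in rational_rep) bil_zero_left:
  "left_module X \<Longrightarrow> \<beta> \<in> bil X Y \<Longrightarrow> y \<in> carrier Y \<Longrightarrow> \<beta> \<zero>\<^bsub>X\<^esub> y = 0"
  by (rule left_module.additive_on_zero[OF _ bilD(2)])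

lemma (in rational_rep) bil_zero_right:
  "left_module Y \<Longrightarrow> \<beta> \<in> bil X Y \<Longrightarrow> x \<in> carrier X \<Longrightarrow> \<beta> x \<zero>\<^bsub>Y\<^esub> = 0"
  by (rule left_module.additive_on_zero[OF _ bilD(1)])

lemma gact_trivial_module:
  "gact (trivial_module :: ('g::group_add \<Rightarrow>\<^sub>0 'k::comm_ring_1, 'k) module) g z = z"
  by (simp add: gact_def trivial_module_def augmentation_def)

text \<open>The point is that the augmentation is a ring homomorphism; multiplicativity is checked
  on monomials in both factors.\<close>

lemma left_module_trivial:
  "left_module (trivial_module :: ('g::group_add \<Rightarrow>\<^sub>0 'k::comm_ring_1, 'k) module)"
proof -
  have aug_add: "augmentation (a + b) = augmentation a + augmentation b" for a b :: "'g \<Rightarrow>\<^sub>0 'k"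
    unfolding augmentation_def by (rule setsum_keys_plus_distrib) simp_all
  have aug_single: "augmentation (Poly_Mapping.single g q) = q" for g :: 'g and q :: 'k
    by (cases "q = 0") (simp_all add: augmentation_def)
  have aug_mult: "augmentation (a * b) = augmentation a * augmentation b" for a b :: "'g \<Rightarrow>\<^sub>0 'k"
  proof (induction a rule: poly_mapping_add_induct)
    case zero
    show ?case by (simp add: augmentation_def)
  next
    case (single g q)
    show ?case
    proof (induction b rule: poly_mapping_add_induct)
      case zero
      show ?case by (simp add: augmentation_def)
    qed (simp_all add: mult_single aug_single aug_add distrib_left)
  qed (simp add: distrib_right aug_add)
  have "abelian_group (trivial_module :: ('g \<Rightarrow>\<^sub>0 'k, 'k) module)"
    by (rule abelian_groupI) (auto simp: trivial_module_def intro: exI[of _ "- _"])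
  then interpret abelian_group "trivial_module :: ('g \<Rightarrow>\<^sub>0 'k, 'k) module" .
  show ?thesis
    by unfold_locales
      (simp_all add: trivial_module_def aug_add aug_mult aug_single distrib_left distrib_right flip: single_one)
qed

subsection \<open>Vanishing of cohomology\<close>

locale rational_complex = rational_rep scale act
  for scale :: "rat \<Rightarrow> 'f::ab_group_add \<Rightarrow> 'f" and act :: "'g::group_add \<Rightarrow> 'f \<Rightarrow> 'f" +
  fixes P :: "nat \<Rightarrow> ('g \<Rightarrow>\<^sub>0 rat, 'm) module" and d :: "nat \<Rightarrow> 'm \<Rightarrow> 'm" and n :: nat
  assumes proj: "projective (P i)"
    and d_hom: "d i \<in> mod_hom (P (Suc i)) (P i)"
    and d_exact: "a_kernel (P (Suc i)) (P i) (d i) = d (Suc i) ` carrier (P (Suc (Suc i)))"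
    and bounded: "i > n \<Longrightarrow> carrier (P i) = {\<zero>\<^bsub>P i\<^esub>}"
begin

lemma P_module: "left_module (P i)"
  using proj by (simp add: projective_def)

lemma d_closed: "x \<in> carrier (P (Suc i)) \<Longrightarrow> d i x \<in> carrier (P i)"
  by (rule mod_homD(1)[OF d_hom])

lemma d_d: "x \<in> carrier (P (Suc (Suc i))) \<Longrightarrow> d i (d (Suc i) x) = \<zero>\<^bsub>P i\<^esub>"
  using d_exact[of i] by (auto simp: a_kernel_def')

lemma d_kernel:
  "x \<in> carrier (P (Suc i)) \<Longrightarrow> d i x = \<zero>\<^bsub>P i\<^esub> \<Longrightarrow> x \<in> d (Suc i) ` carrier (P (Suc (Suc i)))"
  using d_exact[of i] by (auto simp: a_kernel_def')

text \<open>By exactness at \<open>P (Suc i)\<close> a cocycle vanishes on the kernel of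
  \<open>d i\<close>, hence extends along \<open>d i\<close>.\<close>

lemma cocycle_projective:
  fixes T :: "('g \<Rightarrow>\<^sub>0 int, 'n) module"
  assumes T: "projective T" and \<beta>: "\<beta> \<in> bil (P (Suc i)) T"
    and cocycle: "\<And>x t. x \<in> carrier (P (Suc (Suc i))) \<Longrightarrow> t \<in> carrier T \<Longrightarrow> \<beta> (d (Suc i) x) t = 0"
  shows "\<exists>\<zeta>\<in>bil (P i) T. \<forall>x\<in>carrier (P (Suc i)). \<forall>t\<in>carrier T. \<zeta> (d i x) t = \<beta> x t"
proof (rule bil_extend_int[OF T P_module P_module d_hom \<beta>])
  show "\<beta> c x = 0" if "x \<in> carrier T" "c \<in> carrier (P (Suc i))" "d i c = \<zero>\<^bsub>P i\<^esub>" for x c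
    using d_kernel[OF that(2,3)] cocycle that(1) by auto
qed

text \<open>
  The maps on \<open>P i \<times> T j\<close> that vanish on the image of \<open>D (j + 1)\<close> are those on \<open>P i \<times> coker (D (j + 1))\<close>.
\<close>

lemma cocycle_acyclic:
  fixes T :: "int \<Rightarrow> ('g \<Rightarrow>\<^sub>0 int, 'n) module"
  assumes T: "acyclic_complex T D" "\<And>j. projective (T j)"
    and "\<beta> \<in> bil (P (Suc i)) (T j)"
    and "\<And>x t. x \<in> carrier (P (Suc (Suc i))) \<Longrightarrow> t \<in> carrier (T j) \<Longrightarrow> \<beta> (d (Suc i) x) t = 0"
    and "\<And>x t. x \<in> carrier (P (Suc i)) \<Longrightarrow> t \<in> carrier (T (j + 1)) \<Longrightarrow> \<beta> x (D (j + 1) t) = 0"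
  shows "\<exists>\<beta>'\<in>bil (P i) (T j).
    (\<forall>x\<in>carrier (P i). \<forall>t\<in>carrier (T (j + 1)). \<beta>' x (D (j + 1) t) = 0) \<and>
    (\<forall>x\<in>carrier (P (Suc i)). \<forall>t\<in>carrier (T j). \<beta> x t = \<beta>' (d i x) t)"
  using assms(3-)
\<comment> \<open>Dimension shifting raises \<open>i\<close> by one and lowers \<open>j\<close> by
  one; it stops at \<open>i\<close> = \<open>n\<close>, beyond which \<open>P\<close> is
  zero.\<close>
proof (induction "n - i" arbitrary: i j \<beta> rule: less_induct)
  case less
  note \<beta> = less.prems
  have mods: "left_module (T j)" and D: "D j \<in> mod_hom (T j) (T (j - 1))"
    and exact: "a_kernel (T j) (T (j - 1)) (D j) = D (j + 1) ` carrier (T (j + 1))" for j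
    using T(1) by (auto simp: acyclic_complex_def)
  note D_closed = mod_homD(1)[OF D]
  have D_closed': "D (j + 1) t \<in> carrier (T j)" if "t \<in> carrier (T (j + 1))" for t j
    using D_closed[OF that] by simp
  have DD: "D j (D (j + 1) t) = \<zero>\<^bsub>T (j - 1)\<^esub>" if "t \<in> carrier (T (j + 1))" for t
    using that exact[of j] by (auto simp: a_kernel_def')
  show ?case
  proof (cases "n \<le> i")
    case True
    then have "carrier (P (Suc i)) = {\<zero>\<^bsub>P (Suc i)\<^esub>}" by (intro bounded) simp
    then show ?thesis
      using bil_zero_left[OF P_module \<beta>(1)] by (intro bexI[OF _ bil_0]) simp
  next
    case False
    \<comment> \<open>Since \<beta> vanishes on the kernel of \<open>D j\<close>, it extends along
      \<open>D j\<close> to the next term of \<open>T\<close>.\<close>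
    have "\<exists>\<eta>\<in>bil (P (Suc i)) (T (j - 1)). \<forall>x\<in>carrier (P (Suc i)). \<forall>t\<in>carrier (T j). \<eta> x (D j t) = \<beta> x t"
    proof (rule bil_extend_rat[OF proj mods mods D \<beta>(1)])
      fix x t assume x: "x \<in> carrier (P (Suc i))" and "t \<in> carrier (T j)" "D j t = \<zero>\<^bsub>T (j - 1)\<^esub>"
      then have "t \<in> D (j + 1) ` carrier (T (j + 1))"
        unfolding exact[symmetric] by (simp add: a_kernel_def')
      then show "\<beta> x t = 0" using \<beta>(3) x by auto
    qed
    then obtain \<eta> where \<eta>: "\<eta> \<in> bil (P (Suc i)) (T (j - 1))"
      and \<eta>_eq: "\<And>x t. x \<in> carrier (P (Suc i)) \<Longrightarrow> t \<in> carrier (T j) \<Longrightarrow> \<eta> x (D j t) = \<beta> x t"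
      by blast
    \<comment> \<open>The extension \<eta> need not be a cocycle. Its coboundary is one, in the next
      degree, and vanishes on the image of \<open>D j\<close> because \<beta> is a cocycle. The
      induction hypothesis provides \<theta> with the same coboundary that vanishes on this image
      itself.\<close>
    have "\<exists>\<theta>\<in>bil (P (Suc i)) (T (j - 1)).
        (\<forall>x\<in>carrier (P (Suc i)). \<forall>t\<in>carrier (T (j - 1 + 1)). \<theta> x (D (j - 1 + 1) t) = 0) \<and>
        (\<forall>x\<in>carrier (P (Suc (Suc i))). \<forall>t\<in>carrier (T (j - 1)). \<eta> (d (Suc i) x) t = \<theta> (d (Suc i) x) t)"
    proof (rule less.hyps)
      show "n - Suc i < n - i" using False by simp
      show "(\<lambda>x. \<eta> (d (Suc i) x)) \<in> bil (P (Suc (Suc i))) (T (j - 1))"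
        by (rule bil_comp_left[OF \<eta> d_hom])
      show "\<eta> (d (Suc i) (d (Suc (Suc i)) x)) t = 0"
        if "x \<in> carrier (P (Suc (Suc (Suc i))))" "t \<in> carrier (T (j - 1))" for x t
        using that by (simp add: d_d bil_zero_left[OF P_module \<eta>])
      show "\<eta> (d (Suc i) x) (D (j - 1 + 1) t) = 0"
        if "x \<in> carrier (P (Suc (Suc i)))" "t \<in> carrier (T (j - 1 + 1))" for x t
        using that by (simp add: \<eta>_eq d_closed \<beta>(2))
    qed
    then obtain \<theta> where \<theta>: "\<theta> \<in> bil (P (Suc i)) (T (j - 1))"
      and \<theta>_0: "\<And>x t. x \<in> carrier (P (Suc i)) \<Longrightarrow> t \<in> carrier (T j) \<Longrightarrow> \<theta> x (D j t) = 0"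
      and \<theta>_eq: "\<And>x t. x \<in> carrier (P (Suc (Suc i))) \<Longrightarrow> t \<in> carrier (T (j - 1)) \<Longrightarrow>
        \<eta> (d (Suc i) x) t = \<theta> (d (Suc i) x) t"
      by auto
    \<comment> \<open>Now \<eta> - \<theta> is a cocycle on a projective module and still restricts
      to \<beta> along \<open>D j\<close>, so pulling back its primitive \<zeta> along
      \<open>D j\<close> gives a primitive of \<beta>.\<close>
    have "\<exists>\<zeta>\<in>bil (P i) (T (j - 1)). \<forall>x\<in>carrier (P (Suc i)). \<forall>t\<in>carrier (T (j - 1)).
        \<zeta> (d i x) t = \<eta> x t - \<theta> x t"
      by (rule cocycle_projective[OF T(2) bil_diff[OF \<eta> \<theta>]]) (simp add: \<theta>_eq)
    then obtain \<zeta> where \<zeta>: "\<zeta> \<in> bil (P i) (T (j - 1))"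
      and \<zeta>_eq: "\<And>x t. x \<in> carrier (P (Suc i)) \<Longrightarrow> t \<in> carrier (T (j - 1)) \<Longrightarrow>
        \<zeta> (d i x) t = \<eta> x t - \<theta> x t"
      by blast
    show ?thesis
    proof (intro bexI conjI ballI)
      show "(\<lambda>x t. \<zeta> x (D j t)) \<in> bil (P i) (T j)"
        by (rule bil_comp_right[OF \<zeta> D])
      show "\<zeta> x (D j (D (j + 1) t)) = 0" if "x \<in> carrier (P i)" "t \<in> carrier (T (j + 1))" for x t
        using that by (simp add: DD bil_zero_right[OF mods \<zeta>])
      show "\<beta> x t = \<zeta> (d i x) (D j t)" if "x \<in> carrier (P (Suc i))" "t \<in> carrier (T j)" for x t
        using that by (simp add: \<zeta>_eq \<eta>_eq \<theta>_0 D_closed)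
    qed
  qed
qed

text \<open>Pull \<beta> back along the epimorphism \<open>p\<close> from a term of the acyclic
  complex and apply \<open>cocycle_acyclic\<close>. The primitive found there vanishes on the kernel
  of \<open>p\<close>, so it descends to \<open>M\<close>.\<close>

lemma cocycle_Gorenstein:
  fixes M :: "('g \<Rightarrow>\<^sub>0 int, 'n) module"
  assumes M: "Gorenstein_projective M" and \<beta>: "\<beta> \<in> bil (P (Suc i)) M"
    and cocycle: "\<And>x y. x \<in> carrier (P (Suc (Suc i))) \<Longrightarrow> y \<in> carrier M \<Longrightarrow> \<beta> (d (Suc i) x) y = 0"
  shows "\<exists>\<beta>'\<in>bil (P i) M. \<forall>x\<in>carrier (P (Suc i)). \<forall>y\<in>carrier M. \<beta> x y = \<beta>' (d i x) y"
proof -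
  obtain T :: "int \<Rightarrow> ('g \<Rightarrow>\<^sub>0 int, 'n) module" and D j
    where T: "acyclic_complex T D" "\<forall>j. projective (T j)"
      and "\<exists>p\<in>mod_hom (T j) M. p ` carrier (T j) = carrier M \<and>
        a_kernel (T j) M p = D (j + 1) ` carrier (T (j + 1))"
    using M unfolding Gorenstein_projective_def by (elim conjE exE) (rule that; assumption)
  then obtain p where p: "p \<in> mod_hom (T j) M" and onto: "p ` carrier (T j) = carrier M"
    and ker: "a_kernel (T j) M p = D (j + 1) ` carrier (T (j + 1))"
    by blast
  have Mm: "left_module M" using M by (simp add: Gorenstein_projective_def)
  have Tm: "left_module (T j)" using T(2) by (auto simp: projective_def)
  note p_closed = mod_homD(1)[OF p]
  have "p (D (j + 1) t) = \<zero>\<^bsub>M\<^esub>" if "t \<in> carrier (T (j + 1))" for t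
    using ker that by (auto simp: a_kernel_def')
  then have "\<exists>\<beta>'\<in>bil (P i) (T j).
      (\<forall>x\<in>carrier (P i). \<forall>t\<in>carrier (T (j + 1)). \<beta>' x (D (j + 1) t) = 0) \<and>
      (\<forall>x\<in>carrier (P (Suc i)). \<forall>t\<in>carrier (T j). \<beta> x (p t) = \<beta>' (d i x) t)"
    by (intro cocycle_acyclic[OF T(1) T(2)[rule_format] bil_comp_right[OF \<beta> p]])
      (simp_all add: bil_zero_right[OF Mm \<beta>] cocycle p_closed)
  then obtain \<beta>' where \<beta>': "\<beta>' \<in> bil (P i) (T j)"
    and \<beta>'_0: "\<And>x t. x \<in> carrier (P i) \<Longrightarrow> t \<in> carrier (T (j + 1)) \<Longrightarrow> \<beta>' x (D (j + 1) t) = 0"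
    and \<beta>'_eq: "\<And>x t. x \<in> carrier (P (Suc i)) \<Longrightarrow> t \<in> carrier (T j) \<Longrightarrow> \<beta> x (p t) = \<beta>' (d i x) t"
    by blast
  have "\<exists>\<gamma>\<in>bil (P i) M. \<forall>x\<in>carrier (P i). \<forall>t\<in>carrier (T j). \<gamma> x (p t) = \<beta>' x t"
  proof (rule bil_extend_rat[OF proj Tm Mm p \<beta>'])
    fix x t assume x: "x \<in> carrier (P i)" and "t \<in> carrier (T j)" "p t = \<zero>\<^bsub>M\<^esub>"
    then have "t \<in> D (j + 1) ` carrier (T (j + 1))"
      unfolding ker[symmetric] by (simp add: a_kernel_def')
    then show "\<beta>' x t = 0" using \<beta>'_0 x by auto
  qed
  then obtain \<gamma> where "\<gamma> \<in> bil (P i) M"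
    and \<gamma>: "\<And>x t. x \<in> carrier (P i) \<Longrightarrow> t \<in> carrier (T j) \<Longrightarrow> \<gamma> x (p t) = \<beta>' x t" by blast
  moreover have "\<beta> x y = \<gamma> (d i x) y" if x: "x \<in> carrier (P (Suc i))" and y: "y \<in> carrier M" for x y
  proof -
    obtain t where "t \<in> carrier (T j)" "y = p t" using y onto by blast
    then show ?thesis using x by (simp add: \<beta>'_eq \<gamma> d_closed)
  qed
  ultimately show ?thesis by blast
qed

text \<open>A zigzag through the double complex B(\<open>P\<close>, \<open>M\<close>), by induction
  on m - j: each step lowers \<open>i\<close> and raises \<open>j\<close>. The bound m \<le> i + j
  lets \<open>j\<close> reach the end of \<open>M\<close> before \<open>i\<close> runs out.\<close>

lemma cocycle_resolution:
  fixes M :: "nat \<Rightarrow> ('g \<Rightarrow>\<^sub>0 int, 'n) module"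
  assumes M: "\<And>j. Gorenstein_projective (M j)"
    and \<delta>: "\<And>j. \<delta> j \<in> mod_hom (M (Suc j)) (M j)"
    and exact: "\<And>j. a_kernel (M (Suc j)) (M j) (\<delta> j) = \<delta> (Suc j) ` carrier (M (Suc (Suc j)))"
    and M_bounded: "\<And>j. j > m \<Longrightarrow> carrier (M j) = {\<zero>\<^bsub>M j\<^esub>}"
    and "m \<le> i + j" "\<beta> \<in> bil (P (Suc i)) (M j)"
    and "\<And>x y. x \<in> carrier (P (Suc (Suc i))) \<Longrightarrow> y \<in> carrier (M j) \<Longrightarrow> \<beta> (d (Suc i) x) y = 0"
    and "\<And>x y. x \<in> carrier (P (Suc i)) \<Longrightarrow> y \<in> carrier (M (Suc j)) \<Longrightarrow> \<beta> x (\<delta> j y) = 0"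
  shows "\<exists>\<beta>'\<in>bil (P i) (M j).
    (\<forall>x\<in>carrier (P i). \<forall>y\<in>carrier (M (Suc j)). \<beta>' x (\<delta> j y) = 0) \<and>
    (\<forall>x\<in>carrier (P (Suc i)). \<forall>y\<in>carrier (M j). \<beta> x y = \<beta>' (d i x) y)"
  using assms(5-)
proof (induction "m - j" arbitrary: i j \<beta> rule: less_induct)
  case less
  note \<beta> = less.prems(2-)
  have mods: "left_module (M j)" for j using M by (simp add: Gorenstein_projective_def)
  have \<delta>\<delta>: "\<delta> j (\<delta> (Suc j) y) = \<zero>\<^bsub>M j\<^esub>" if "y \<in> carrier (M (Suc (Suc j)))" for y
    using that exact[of j] by (auto simp: a_kernel_def')
  note \<delta>_closed = mod_homD(1)[OF \<delta>]
  \<comment> \<open>This is a primitive of \<beta>, but it need not vanish on the image of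
    \<open>\<delta> j\<close>; the rest of the proof corrects that.\<close>
  obtain \<eta> where \<eta>: "\<eta> \<in> bil (P i) (M j)"
    and \<eta>_eq: "\<And>x y. x \<in> carrier (P (Suc i)) \<Longrightarrow> y \<in> carrier (M j) \<Longrightarrow> \<beta> x y = \<eta> (d i x) y"
    using cocycle_Gorenstein[OF M \<beta>(1)] \<beta>(2) by blast
  show ?case
  proof (cases "m \<le> j")
    case True
    then have "carrier (M (Suc j)) = {\<zero>\<^bsub>M (Suc j)\<^esub>}" by (intro M_bounded) simp
    then have "\<eta> x (\<delta> j y) = 0" if "x \<in> carrier (P i)" "y \<in> carrier (M (Suc j))" for x y
      using that bil_zero_right[OF mods \<eta>] mod_hom_zero[OF mods mods \<delta>] by simp
    then show ?thesis using \<eta> \<eta>_eq by blast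
  next
    case False
    then obtain i' where i: "i = Suc i'" using less.prems(1) by (cases i) auto
    \<comment> \<open>The defect \<eta>(x, \<delta> j y) is a cocycle, because its coboundary is
      \<beta>(x, \<delta> j y) = 0; the induction hypothesis applies to it at \<open>i'\<close> and
      \<open>Suc j\<close>.\<close>
    have "\<exists>u\<in>bil (P i') (M (Suc j)).
        (\<forall>x\<in>carrier (P i'). \<forall>y\<in>carrier (M (Suc (Suc j))). u x (\<delta> (Suc j) y) = 0) \<and>
        (\<forall>x\<in>carrier (P (Suc i')). \<forall>y\<in>carrier (M (Suc j)). \<eta> x (\<delta> j y) = u (d i' x) y)"
    proof (rule less.hyps)
      show "m - Suc j < m - j" using False by simp
      show "m \<le> i' + Suc j" using less.prems(1) i by simp
      show "(\<lambda>x y. \<eta> x (\<delta> j y)) \<in> bil (P (Suc i')) (M (Suc j))"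
        using bil_comp_right[OF \<eta> \<delta>] i by simp
      show "\<eta> (d (Suc i') x) (\<delta> j y) = 0"
        if "x \<in> carrier (P (Suc (Suc i')))" "y \<in> carrier (M (Suc j))" for x y
        using that \<eta>_eq[of x "\<delta> j y"] \<beta>(3)[of x y] \<delta>_closed i by simp
      show "\<eta> x (\<delta> j (\<delta> (Suc j) y)) = 0"
        if "x \<in> carrier (P (Suc i'))" "y \<in> carrier (M (Suc (Suc j)))" for x y
        using that bil_zero_right[OF mods \<eta>] i by (simp add: \<delta>\<delta>)
    qed
    then obtain u where u: "u \<in> bil (P i') (M (Suc j))"
      and u_0: "\<And>x y. x \<in> carrier (P i') \<Longrightarrow> y \<in> carrier (M (Suc (Suc j))) \<Longrightarrow> u x (\<delta> (Suc j) y) = 0"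
      and u_eq: "\<And>x y. x \<in> carrier (P i) \<Longrightarrow> y \<in> carrier (M (Suc j)) \<Longrightarrow> \<eta> x (\<delta> j y) = u (d i' x) y"
      unfolding i by blast
    have "\<exists>v\<in>bil (P i') (M j). \<forall>x\<in>carrier (P i'). \<forall>y\<in>carrier (M (Suc j)). v x (\<delta> j y) = u x y"
    proof (rule bil_extend_rat[OF proj mods mods \<delta> u])
      fix x y assume x: "x \<in> carrier (P i')" and "y \<in> carrier (M (Suc j))" "\<delta> j y = \<zero>\<^bsub>M j\<^esub>"
      then have "y \<in> \<delta> (Suc j) ` carrier (M (Suc (Suc j)))"
        unfolding exact[symmetric] by (simp add: a_kernel_def')
      then show "u x y = 0" using u_0 x by auto
    qed
    then obtain v where v: "v \<in> bil (P i') (M j)"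
      and v_eq: "\<And>x y. x \<in> carrier (P i') \<Longrightarrow> y \<in> carrier (M (Suc j)) \<Longrightarrow> v x (\<delta> j y) = u x y"
      by blast
    have d: "d i' \<in> mod_hom (P i) (P i')" unfolding i by (rule d_hom)
    show ?thesis
    proof (intro bexI conjI ballI)
      \<comment> \<open>Subtracting the coboundary of \<open>v\<close> removes the defect and leaves
        the coboundary of \<eta> unchanged, as d d = 0.\<close>
      show "(\<lambda>x y. \<eta> x y - v (d i' x) y) \<in> bil (P i) (M j)"
        by (intro bil_diff \<eta> bil_comp_left[OF v d])
      show "\<eta> x (\<delta> j y) - v (d i' x) (\<delta> j y) = 0"
        if "x \<in> carrier (P i)" "y \<in> carrier (M (Suc j))" for x y
        using that mod_homD(1)[OF d] by (simp add: u_eq v_eq)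
      show "\<beta> x y = \<eta> (d i x) y - v (d i' (d i x)) y"
        if "x \<in> carrier (P (Suc i))" "y \<in> carrier (M j)" for x y
        using that d_d[of x i'] bil_zero_left[OF P_module v] by (simp add: \<eta>_eq i)
    qed
  qed
qed

text \<open>The cocycle \<open>f\<close> enters the double complex as \<open>f \<otimes> \<epsilon>\<close>.\<close>

lemma cocycle_coboundary:
  fixes M :: "nat \<Rightarrow> ('g \<Rightarrow>\<^sub>0 int, 'n) module"
  assumes M: "\<And>j. Gorenstein_projective (M j)"
    and \<delta>: "\<And>j. \<delta> j \<in> mod_hom (M (Suc j)) (M j)"
    and exact: "\<And>j. a_kernel (M (Suc j)) (M j) (\<delta> j) = \<delta> (Suc j) ` carrier (M (Suc (Suc j)))"
    and M_bounded: "\<And>j. j > m \<Longrightarrow> carrier (M j) = {\<zero>\<^bsub>M j\<^esub>}"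
    and \<epsilon>: "\<epsilon> \<in> mod_hom (M 0) (trivial_module :: ('g \<Rightarrow>\<^sub>0 int, int) module)"
      "\<epsilon> ` carrier (M 0) = carrier (trivial_module :: ('g \<Rightarrow>\<^sub>0 int, int) module)"
      "a_kernel (M 0) (trivial_module :: ('g \<Rightarrow>\<^sub>0 int, int) module) \<epsilon> = \<delta> 0 ` carrier (M 1)"
    and k: "m \<le> k"
    and f: "additive_on (P (Suc k)) f"
      "\<And>g x. x \<in> carrier (P (Suc k)) \<Longrightarrow> f (gact (P (Suc k)) g x) = act g (f x)"
      "\<And>x. x \<in> carrier (P (Suc (Suc k))) \<Longrightarrow> f (d (Suc k) x) = 0"
  shows "\<exists>h. additive_on (P k) h \<and> (\<forall>g. \<forall>x\<in>carrier (P k). h (gact (P k) g x) = act g (h x)) \<and>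
    (\<forall>x\<in>carrier (P (Suc k)). h (d k x) = f x)"
proof -
  let ?Z = "trivial_module :: ('g \<Rightarrow>\<^sub>0 int, int) module"
  have M0: "left_module (M 0)" using M by (simp add: Gorenstein_projective_def)
  have \<epsilon>_add: "\<epsilon> (y \<oplus>\<^bsub>M 0\<^esub> z) = \<epsilon> y + \<epsilon> z" if "y \<in> carrier (M 0)" "z \<in> carrier (M 0)" for y z
    using mod_homD(2)[OF \<epsilon>(1) that] by (simp add: trivial_module_def)
  have \<epsilon>_gact: "\<epsilon> (gact (M 0) g y) = \<epsilon> y" if "y \<in> carrier (M 0)" for g y
    using mod_hom_gact[OF \<epsilon>(1) that] by (simp add: gact_trivial_module)
  have \<epsilon>\<delta>: "\<epsilon> (\<delta> 0 y) = 0" if "y \<in> carrier (M 1)" for y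
    using that \<epsilon>(3) by (auto simp: a_kernel_def' trivial_module_def)
  \<comment> \<open>Equivariance holds because \<epsilon> is invariant under
    \<open>G\<close>.\<close>
  have f\<epsilon>: "(\<lambda>x y. scale (of_int (\<epsilon> y)) (f x)) \<in> bil (P (Suc k)) (M 0)"
    by (simp add: bil_def additive_on_def \<epsilon>_add \<epsilon>_gact additive_onD[OF f(1)] f(2) act_scale
        scale_left_distrib scale_right_distrib)
  have "\<exists>\<beta>\<in>bil (P k) (M 0).
      (\<forall>x\<in>carrier (P k). \<forall>y\<in>carrier (M (Suc 0)). \<beta> x (\<delta> 0 y) = 0) \<and>
      (\<forall>x\<in>carrier (P (Suc k)). \<forall>y\<in>carrier (M 0). scale (of_int (\<epsilon> y)) (f x) = \<beta> (d k x) y)"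
  proof (rule cocycle_resolution[OF M \<delta> exact M_bounded _ f\<epsilon>])
    show "m \<le> k + 0" using k by simp
  qed (simp_all add: f(3) \<epsilon>\<delta>)
  then obtain \<beta> where \<beta>: "\<beta> \<in> bil (P k) (M 0)"
    and \<beta>_0: "\<And>x y. x \<in> carrier (P k) \<Longrightarrow> y \<in> carrier (M 1) \<Longrightarrow> \<beta> x (\<delta> 0 y) = 0"
    and \<beta>_eq: "\<And>x y. x \<in> carrier (P (Suc k)) \<Longrightarrow> y \<in> carrier (M 0) \<Longrightarrow>
      scale (of_int (\<epsilon> y)) (f x) = \<beta> (d k x) y"
    by auto
  have "\<exists>\<gamma>\<in>bil (P k) ?Z. \<forall>x\<in>carrier (P k). \<forall>y\<in>carrier (M 0). \<gamma> x (\<epsilon> y) = \<beta> x y"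
  proof (rule bil_extend_rat[OF proj M0 left_module_trivial \<epsilon>(1) \<beta>])
    fix x y assume x: "x \<in> carrier (P k)" and "y \<in> carrier (M 0)" "\<epsilon> y = \<zero>\<^bsub>?Z\<^esub>"
    then have "y \<in> \<delta> 0 ` carrier (M 1)"
      unfolding \<epsilon>(3)[symmetric] by (simp add: a_kernel_def')
    then show "\<beta> x y = 0" using \<beta>_0 x by auto
  qed
  then obtain \<gamma> where \<gamma>: "\<gamma> \<in> bil (P k) ?Z"
    and \<gamma>_eq: "\<And>x y. x \<in> carrier (P k) \<Longrightarrow> y \<in> carrier (M 0) \<Longrightarrow> \<gamma> x (\<epsilon> y) = \<beta> x y" by blast
  have univ: "z \<in> carrier ?Z" for z by (simp add: trivial_module_def)
  obtain y where y: "y \<in> carrier (M 0)" "\<epsilon> y = 1" using \<epsilon>(2) univ[of 1] by (metis imageE)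
  show ?thesis
  \<comment> \<open>The group fixes 1, so evaluation there is equivariant; as 1 = \<epsilon> y, it
    recovers \<open>f\<close>.\<close>
  proof (intro exI[of _ "\<lambda>x. \<gamma> x 1"] conjI allI ballI)
    show "additive_on (P k) (\<lambda>x. \<gamma> x 1)" by (rule bilD(2)[OF \<gamma> univ])
    show "\<gamma> (gact (P k) g x) 1 = act g (\<gamma> x 1)" if "x \<in> carrier (P k)" for g x
      using bilD(3)[OF \<gamma> that univ, of g 1] by (simp add: gact_trivial_module)
    show "\<gamma> (d k x) 1 = f x" if "x \<in> carrier (P (Suc k))" for x
      using \<gamma>_eq[OF d_closed[OF that] y(1)] \<beta>_eq[OF that y(1)] y(2) by simp
  qed
qed

end

section \<open>Splitting off the top term of the projective resolution\<close>

text \<open>Scalar multiplication on the free module F with basis the whole type \<open>'m\<close>.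
  Unlike the record \<open>free_cover\<close>, this F is a type of class
  \<open>ab_group_add\<close>, as \<open>rational_rep\<close> requires.\<close>

lift_definition coeff_mult :: "'r::ring_1 \<Rightarrow> ('m \<Rightarrow>\<^sub>0 'r) \<Rightarrow> ('m \<Rightarrow>\<^sub>0 'r)" is "\<lambda>a v x. a * v x"
  by (rule finite_subset[rotated], assumption) auto

lemma rational_rep_coeff_mult:
  "rational_rep (\<lambda>q. coeff_mult (Poly_Mapping.single 0 q))
     (\<lambda>g. coeff_mult (Poly_Mapping.single g 1) :: ('m \<Rightarrow>\<^sub>0 ('g::group_add \<Rightarrow>\<^sub>0 rat)) \<Rightarrow> _)"
proof -
  have "coeff_mult a (v + w) = coeff_mult a v + coeff_mult a w"
    for a :: "'g \<Rightarrow>\<^sub>0 rat" and v w :: "'m \<Rightarrow>\<^sub>0 ('g \<Rightarrow>\<^sub>0 rat)"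
    by transfer (simp add: distrib_left)
  moreover have "coeff_mult (a + b) v = coeff_mult a v + coeff_mult b v"
    for a b :: "'g \<Rightarrow>\<^sub>0 rat" and v :: "'m \<Rightarrow>\<^sub>0 ('g \<Rightarrow>\<^sub>0 rat)"
    by (rule poly_mapping_eqI) (simp add: coeff_mult.rep_eq lookup_add distrib_right)
  moreover have "coeff_mult a (coeff_mult b v) = coeff_mult (a * b) v"
    for a b :: "'g \<Rightarrow>\<^sub>0 rat" and v :: "'m \<Rightarrow>\<^sub>0 ('g \<Rightarrow>\<^sub>0 rat)"
    by (rule poly_mapping_eqI) (simp add: coeff_mult.rep_eq mult.assoc)
  moreover have "coeff_mult 1 v = v" for v :: "'m \<Rightarrow>\<^sub>0 ('g \<Rightarrow>\<^sub>0 rat)"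
    by (rule poly_mapping_eqI) (simp add: coeff_mult.rep_eq)
  ultimately show ?thesis
    by unfold_locales (simp_all add: single_add mult_single)
qed

text \<open>The embedding of the top term into F is a cocycle, as the next term is zero. A primitive
  \<open>h\<close> of it, followed by the projection of F onto the top term, is a retraction of
  \<open>d k\<close>.\<close>

lemma resolution_splits:
  fixes P :: "nat \<Rightarrow> ('g::group_add \<Rightarrow>\<^sub>0 rat, 'm) module" and M :: "nat \<Rightarrow> ('g \<Rightarrow>\<^sub>0 int, 'n) module"
  assumes P: "\<And>i. projective (P i)"
    and d: "\<And>i. d i \<in> mod_hom (P (Suc i)) (P i)"
    and d_exact: "\<And>i. a_kernel (P (Suc i)) (P i) (d i) = d (Suc i) ` carrier (P (Suc (Suc i)))"
    and P_bounded: "\<And>i. i > Suc k \<Longrightarrow> carrier (P i) = {\<zero>\<^bsub>P i\<^esub>}"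
    and M: "has_resolution (Gorenstein_projective :: ('g \<Rightarrow>\<^sub>0 int, 'n) module \<Rightarrow> bool)
      (trivial_module :: ('g \<Rightarrow>\<^sub>0 int, int) module) m"
    and k: "m \<le> k"
  shows "\<exists>r\<in>mod_hom (P k) (P (Suc k)). \<forall>x\<in>carrier (P (Suc k)). r (d k x) = x"
proof -
  let ?act = "\<lambda>g. coeff_mult (Poly_Mapping.single g 1) :: ('m \<Rightarrow>\<^sub>0 ('g \<Rightarrow>\<^sub>0 rat)) \<Rightarrow> _"
  interpret rational_rep "\<lambda>q. coeff_mult (Poly_Mapping.single 0 q)" ?act
    by (rule rational_rep_coeff_mult)
  interpret rational_complex "\<lambda>q. coeff_mult (Poly_Mapping.single 0 q)" ?act P d "Suc k"
    by (intro rational_complex.intro rational_complex_axioms.intro rational_rep_axioms)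
      (fact P d d_exact P_bounded)+
  let ?Q = "P (Suc k)"
  interpret Q: left_module ?Q by (rule P_module)
  interpret Pk: left_module "P k" by (rule P_module)
  obtain s e where s: "s \<in> mod_hom ?Q (free_cover ?Q)" and e: "e \<in> mod_hom (free_cover ?Q) ?Q"
    and es: "\<And>x. x \<in> carrier ?Q \<Longrightarrow> e (s x) = x"
    using projective_retract_free_cover[OF P[of "Suc k"]] by blast
  have supp: "finite {x. s y x \<noteq> 0}" "{x. s y x \<noteq> 0} \<subseteq> carrier ?Q" if "y \<in> carrier ?Q" for y
    using mod_homD(1)[OF s that] by (auto simp: free_cover_def)
  define f where "f y = Abs_poly_mapping (s y)" for y
  have f: "Poly_Mapping.lookup (f y) = s y" if "y \<in> carrier ?Q" for y
    using supp(1)[OF that] by (simp add: f_def)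
  have f_add: "additive_on ?Q f"
    unfolding additive_on_def
    by (intro ballI, rule poly_mapping_eqI)
      (simp add: f lookup_add mod_homD(2)[OF s], simp add: free_cover_def)
  have f_act: "f (gact ?Q g y) = ?act g (f y)" if "y \<in> carrier ?Q" for g y
    by (rule poly_mapping_eqI)
      (simp add: that f coeff_mult.rep_eq gact_def mod_homD(3)[OF s], simp add: free_cover_def)
  have f_d: "f (d (Suc k) x) = 0" if "x \<in> carrier (P (Suc (Suc k)))" for x
  proof -
    have "x = \<zero>\<^bsub>P (Suc (Suc k))\<^esub>" using that P_bounded[of "Suc (Suc k)"] by simp
    then show ?thesis
      by (simp add: mod_hom_zero[OF P_module P_module d] Q.additive_on_zero[OF f_add])
  qed
  obtain N \<delta> \<epsilon> where N: "\<forall>i. left_module (N i) \<and> Gorenstein_projective (N i :: ('g \<Rightarrow>\<^sub>0 int, 'n) module)"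
      "\<forall>i>m. carrier (N i) = {\<zero>\<^bsub>N i\<^esub>}" "\<forall>i. \<delta> i \<in> mod_hom (N (Suc i)) (N i)"
      "\<epsilon> \<in> mod_hom (N 0) (trivial_module :: ('g \<Rightarrow>\<^sub>0 int, int) module)"
      "\<epsilon> ` carrier (N 0) = carrier (trivial_module :: ('g \<Rightarrow>\<^sub>0 int, int) module)"
      "a_kernel (N 0) (trivial_module :: ('g \<Rightarrow>\<^sub>0 int, int) module) \<epsilon> = \<delta> 0 ` carrier (N 1)"
      "\<forall>i. a_kernel (N (Suc i)) (N i) (\<delta> i) = \<delta> (Suc i) ` carrier (N (Suc (Suc i)))"
    using M unfolding has_resolution_def by (elim exE conjE) (rule that; assumption)
  have "\<exists>h. additive_on (P k) h \<and> (\<forall>g. \<forall>x\<in>carrier (P k). h (gact (P k) g x) = ?act g (h x)) \<and>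
    (\<forall>x\<in>carrier ?Q. h (d k x) = f x)"
  proof (rule cocycle_coboundary[of N \<delta> m \<epsilon>, OF _ _ _ _ N(4-6) k f_add f_act f_d])
    show "Gorenstein_projective (N j)" "\<delta> j \<in> mod_hom (N (Suc j)) (N j)"
      "a_kernel (N (Suc j)) (N j) (\<delta> j) = \<delta> (Suc j) ` carrier (N (Suc (Suc j)))" for j
      using N(1,3,7) by simp_all
    show "m < j \<Longrightarrow> carrier (N j) = {\<zero>\<^bsub>N j\<^esub>}" for j using N(2) by simp
  qed
  then obtain h where h_add: "additive_on (P k) h"
    and h_act: "\<And>g x. x \<in> carrier (P k) \<Longrightarrow> h (gact (P k) g x) = ?act g (h x)"
    and hd: "\<And>x. x \<in> carrier ?Q \<Longrightarrow> h (d k x) = f x"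
    by blast
  \<comment> \<open>Additivity and equivariance already give linearity over the group ring, since
    additive maps between rational vector spaces are linear.\<close>
  have h_smult: "h (a \<odot>\<^bsub>P k\<^esub> x) = coeff_mult a (h x)" if x: "x \<in> carrier (P k)" for a x
  proof (induction a rule: poly_mapping_add_induct)
    case zero
    have "coeff_mult 0 (h x) = 0" by transfer simp
    then show ?case using x by (simp add: Pk.additive_on_zero[OF h_add])
  next
    case (single g q)
    have "Poly_Mapping.single g q \<odot>\<^bsub>P k\<^esub> x = Poly_Mapping.single 0 q \<odot>\<^bsub>P k\<^esub> gact (P k) g x"
      using x by (simp add: gact_def mult_single flip: Pk.smult_assoc)
    then have "h (Poly_Mapping.single g q \<odot>\<^bsub>P k\<^esub> x) = coeff_mult (Poly_Mapping.single 0 q) (?act g (h x))"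
      using x by (simp add: additive_on_rat[OF P_module h_add] gact_closed P_module h_act)
    also have "\<dots> = coeff_mult (Poly_Mapping.single g q) (h x)"
      by (rule poly_mapping_eqI) (simp add: coeff_mult.rep_eq mult_single flip: mult.assoc)
    finally show ?case .
  next
    case (add a b)
    moreover have "coeff_mult (a + b) (h x) = coeff_mult a (h x) + coeff_mult b (h x)"
      by (rule poly_mapping_eqI) (simp add: coeff_mult.rep_eq lookup_add distrib_right)
    ultimately show ?case
      using x by (simp add: Pk.smult_l_distr additive_onD[OF h_add])
  qed
  \<comment> \<open>Forget the coordinates of F outside the carrier, so as to land in the free cover
    of the top term.\<close>
  define res where "res v = (\<lambda>x. if x \<in> carrier ?Q then Poly_Mapping.lookup v x else 0)"
    for v :: "'m \<Rightarrow>\<^sub>0 ('g \<Rightarrow>\<^sub>0 rat)"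
  have res: "res v \<in> carrier (free_cover ?Q)" for v
  proof -
    have "{x. res v x \<noteq> 0} \<subseteq> Poly_Mapping.keys v" by (auto simp: res_def in_keys_iff)
    then have "finite {x. res v x \<noteq> 0}" by (rule finite_subset) simp
    then show ?thesis by (auto simp: free_cover_def res_def)
  qed
  have res_add: "res (v + w) = res v \<oplus>\<^bsub>free_cover ?Q\<^esub> res w" for v w
    by (auto simp: res_def free_cover_def lookup_add)
  have res_smult: "res (coeff_mult a v) = a \<odot>\<^bsub>free_cover ?Q\<^esub> res v" for a v
    by (auto simp: res_def free_cover_def coeff_mult.rep_eq)
  show ?thesis
  proof (intro bexI ballI)
    show "(\<lambda>x. e (res (h x))) \<in> mod_hom (P k) ?Q"
      by (simp add: mod_hom_def Pi_iff additive_onD[OF h_add] h_smult res_add res_smult res mod_homD[OF e])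
    show "e (res (h (d k x))) = x" if "x \<in> carrier ?Q" for x
    proof -
      have "res (f x) = s x" using supp(2)[OF that] by (intro ext) (auto simp: res_def f[OF that])
      then show ?thesis by (simp add: hd that es)
    qed
  qed
qed

subsection \<open>Shortening a resolution\<close>

lemma projective_retract:
  fixes P P' :: "('r::ring_1, 'm) module"
  assumes P: "projective P" and P': "left_module P'" and \<pi>: "\<pi> \<in> mod_hom P P'"
    and \<iota>: "\<iota> \<in> mod_hom P' P" and \<pi>\<iota>: "\<And>x. x \<in> carrier P' \<Longrightarrow> \<pi> (\<iota> x) = x"
  shows "projective P'"
  unfolding projective_def
proof (intro conjI P' allI impI ballI)
  fix A :: "('r, 'm \<Rightarrow> 'r) module" and B :: "('r, 'm) module" and p f
  assume A: "left_module A" and B: "left_module B" and p: "p \<in> mod_hom A B" "p ` carrier A = carrier B"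
    and f: "f \<in> mod_hom P' B"
  have "(\<lambda>x. f (\<pi> x)) \<in> mod_hom P B"
    by (simp add: mod_hom_def mod_homD[OF f] mod_homD[OF \<pi>])
  from projective_lift[OF P A B p this] obtain g where g: "g \<in> mod_hom P A"
    and pg: "\<And>x. x \<in> carrier P \<Longrightarrow> p (g x) = f (\<pi> x)" by blast
  show "\<exists>g\<in>mod_hom P' A. \<forall>x\<in>carrier P'. p (g x) = f x"
  proof (intro bexI ballI)
    show "(\<lambda>x. g (\<iota> x)) \<in> mod_hom P' A"
      by (simp add: mod_hom_def mod_homD[OF g] mod_homD[OF \<iota>])
    show "p (g (\<iota> x)) = f x" if "x \<in> carrier P'" for x
      using that by (simp add: pg mod_homD[OF \<iota>] \<pi>\<iota>)
  qed
qed

lemma (in left_module) left_module_submodule: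
  assumes S: "S \<subseteq> carrier M" "\<zero> \<in> S" "\<And>x y. x \<in> S \<Longrightarrow> y \<in> S \<Longrightarrow> x \<oplus> y \<in> S"
    "\<And>a x. x \<in> S \<Longrightarrow> a \<odot> x \<in> S"
  shows "left_module (M\<lparr>carrier := S\<rparr>)"
proof -
  note mem = subsetD[OF S(1)]
  have "abelian_group (M\<lparr>carrier := S\<rparr>)"
  proof (rule abelian_groupI)
    fix x assume "x \<in> carrier (M\<lparr>carrier := S\<rparr>)"
    then show "\<exists>y\<in>carrier (M\<lparr>carrier := S\<rparr>). y \<oplus>\<^bsub>M\<lparr>carrier := S\<rparr>\<^esub> x = \<zero>\<^bsub>M\<lparr>carrier := S\<rparr>\<^esub>"
      using S(4)[of x "-1"] mem[of x] by (intro bexI[of _ "(- 1) \<odot> x"]) (simp_all add: smult_minus_one l_neg)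
  qed (use S mem in \<open>simp_all add: a_ac\<close>)
  then interpret S: abelian_group "M\<lparr>carrier := S\<rparr>" .
  show ?thesis
    by unfold_locales
      (use S mem in \<open>simp_all add: smult_l_distr smult_r_distr smult_assoc\<close>)
qed

text \<open>The retraction \<open>r\<close> gives \<open>P k = ker r \<oplus> d k (P (k + 1))\<close>; keep only \<open>ker r\<close>.\<close>

lemma has_resolution_shorten:
  fixes P :: "nat \<Rightarrow> ('r::ring_1, 'm) module"
  assumes P: "\<And>i. projective (P i)" and N: "left_module N"
    and bounded: "\<And>i. i > Suc k \<Longrightarrow> carrier (P i) = {\<zero>\<^bsub>P i\<^esub>}"
    and d: "\<And>i. d i \<in> mod_hom (P (Suc i)) (P i)"
    and e: "e \<in> mod_hom (P 0) N" "e ` carrier (P 0) = carrier N"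
      "a_kernel (P 0) N e = d 0 ` carrier (P 1)"
    and exact: "\<And>i. a_kernel (P (Suc i)) (P i) (d i) = d (Suc i) ` carrier (P (Suc (Suc i)))"
    and r: "r \<in> mod_hom (P k) (P (Suc k))" "\<And>x. x \<in> carrier (P (Suc k)) \<Longrightarrow> r (d k x) = x"
  shows "has_resolution (projective :: ('r, 'm) module \<Rightarrow> bool) N k"
proof -
  have mods: "left_module (P i)" for i using P by (simp add: projective_def)
  note dD = mod_homD[OF d] and rD = mod_homD[OF r(1)] and eD = mod_homD[OF e(1)]
  note d_zero = mod_hom_zero[OF mods mods d]
  interpret Pk: left_module "P k" by (rule mods)
  interpret Q: left_module "P (Suc k)" by (rule mods)
  interpret N: left_module N by (rule N)
  define C where "C i = (if i < k then carrier (P i)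
    else if i = k then {x \<in> carrier (P k). r x = \<zero>\<^bsub>P (Suc k)\<^esub>} else {\<zero>\<^bsub>P i\<^esub>})" for i
  define P' where "P' i = (P i)\<lparr>carrier := C i\<rparr>" for i
  \<comment> \<open>The projection of \<open>P k\<close> onto the kernel of \<open>r\<close> along
    the image of \<open>d k\<close>.\<close>
  define \<pi> where "\<pi> x = x \<oplus>\<^bsub>P k\<^esub> (- 1) \<odot>\<^bsub>P k\<^esub> d k (r x)" for x
  have C_sub: "C i \<subseteq> carrier (P i)" for i
    using abelian_monoid.zero_closed[of "P i"] mods[of i]
    by (auto simp: C_def left_module_def abelian_group_def)
  have \<pi>_C: "\<pi> x \<in> C k" if "x \<in> carrier (P k)" for x
  proof -
    have "r (\<pi> x) = r x \<oplus>\<^bsub>P (Suc k)\<^esub> (- 1) \<odot>\<^bsub>P (Suc k)\<^esub> r x"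
      using that by (simp add: \<pi>_def rD dD r(2))
    also have "\<dots> = \<zero>\<^bsub>P (Suc k)\<^esub>" using that by (simp add: Q.smult_minus_one rD Q.r_neg)
    finally show ?thesis using that by (simp add: C_def \<pi>_def rD dD)
  qed
  have \<pi>_id: "\<pi> x = x" if "x \<in> C k" for x
    using that d_zero by (simp add: C_def \<pi>_def)
  \<comment> \<open>A map that kills the image of \<open>d k\<close> does not notice the projection,
    so it has the same image on the kernel of \<open>r\<close> as on all of
    \<open>P k\<close>.\<close>
  have collapse: "h (\<pi> x) = h x"
    if h: "h \<in> mod_hom (P k) L" and L: "left_module L" and x: "x \<in> carrier (P k)"
      and hd: "\<And>y. y \<in> carrier (P (Suc k)) \<Longrightarrow> h (d k y) = \<zero>\<^bsub>L\<^esub>" for h x and L :: "('r, 'l) module"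
  proof -
    interpret L: left_module L by (rule L)
    show ?thesis using x by (simp add: \<pi>_def mod_homD[OF h] dD rD hd)
  qed
  have P'_module: "left_module (P' i)" for i
  proof -
    interpret Pi: left_module "P i" by (rule mods)
    show ?thesis
      unfolding P'_def
    proof (rule Pi.left_module_submodule[OF C_sub])
      show "\<zero>\<^bsub>P i\<^esub> \<in> C i" by (simp add: C_def mod_hom_zero[OF mods mods r(1)])
      show "x \<oplus>\<^bsub>P i\<^esub> y \<in> C i" if "x \<in> C i" "y \<in> C i" for x y
        using that by (auto simp: C_def rD split: if_splits)
      show "a \<odot>\<^bsub>P i\<^esub> x \<in> C i" if "x \<in> C i" for a x
        using that by (auto simp: C_def rD split: if_splits)
    qed
  qed
  have inj: "(\<lambda>x. x) \<in> mod_hom (P' i) (P i)" for i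
    using C_sub by (auto simp: mod_hom_def P'_def)
  have "projective (P' i)" for i
  proof -
    consider "i < k" | "i = k" | "i > k" by linarith
    then show ?thesis
    proof cases
      case 1
      then show ?thesis using P[of i] by (simp add: P'_def C_def)
    next
      case 2
      have "\<pi> \<in> mod_hom (P k) (P' k)"
        unfolding mod_hom_def
      proof (intro CollectI conjI ballI allI Pi_I)
        show "\<pi> x \<in> carrier (P' k)" if "x \<in> carrier (P k)" for x
          using \<pi>_C[OF that] by (simp add: P'_def)
        show "\<pi> (x \<oplus>\<^bsub>P k\<^esub> y) = \<pi> x \<oplus>\<^bsub>P' k\<^esub> \<pi> y" if "x \<in> carrier (P k)" "y \<in> carrier (P k)" for x y
          using that by (simp add: P'_def \<pi>_def rD dD Pk.smult_r_distr Pk.a_ac)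
        show "\<pi> (a \<odot>\<^bsub>P k\<^esub> x) = a \<odot>\<^bsub>P' k\<^esub> \<pi> x" if "x \<in> carrier (P k)" for a x
          using that by (simp add: P'_def \<pi>_def rD dD Pk.smult_r_distr flip: Pk.smult_assoc)
      qed
      then show ?thesis
        unfolding 2 by (rule projective_retract[OF P P'_module _ inj]) (simp add: P'_def \<pi>_id)
    next
      case 3
      interpret Pi: left_module "P i" by (rule mods)
      have "(\<lambda>x. \<zero>\<^bsub>P i\<^esub>) \<in> mod_hom (P i) (P' i)"
        using 3 by (simp add: mod_hom_def P'_def C_def)
      then show ?thesis
        by (rule projective_retract[OF P P'_module _ inj]) (use 3 in \<open>simp add: P'_def C_def\<close>)
    qed
  qed
  moreover have "C i = {\<zero>\<^bsub>P i\<^esub>}" if "i > k" for i using that by (simp add: C_def)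
  moreover have "d i \<in> mod_hom (P' (Suc i)) (P' i)" for i
  proof -
    have "d i x \<in> C i" if "x \<in> C (Suc i)" for x
    proof (cases "i < k")
      case True
      then show ?thesis using subsetD[OF C_sub that] dD(1) by (simp add: C_def)
    next
      case False
      then show ?thesis using that d_zero mod_hom_zero[OF mods mods r(1)] Pk.zero_closed
        by (auto simp: C_def)
    qed
    then show ?thesis
      using subsetD[OF C_sub] dD by (simp add: mod_hom_def P'_def)
  qed
  moreover have "e \<in> mod_hom (P' 0) N"
    using eD subsetD[OF C_sub] by (simp add: mod_hom_def P'_def)
  moreover have "e ` C 0 = carrier N"
  proof (cases "k = 0")
    case True
    have "e (d 0 y) = \<zero>\<^bsub>N\<^esub>" if "y \<in> carrier (P (Suc 0))" for y
      using e(3) that by (auto simp: a_kernel_def')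
    then have "e (\<pi> x) = e x" if "x \<in> carrier (P 0)" for x
      using collapse[of e N x] e(1) N that True by simp
    then have "e ` carrier (P 0) \<subseteq> e ` C 0" using \<pi>_C True by (metis image_eqI image_subsetI)
    then show ?thesis using e(2) C_sub by blast
  next
    case False
    then show ?thesis using e(2) by (simp add: C_def)
  qed
  \<comment> \<open>With the old exactness this is exactness of the shortened complex. At
    \<open>i\<close> = \<open>k\<close> both sides are zero, since \<open>r\<close> is injective on
    the image of \<open>d k\<close>.\<close>
  moreover have ker: "C i \<inter> d i ` carrier (P (Suc i)) = d i ` C (Suc i)" for i
  proof -
    consider "Suc i < k" | "Suc i = k" | "i = k" | "i > k" by linarith
    then show ?thesis
    proof cases
      case 1
      then show ?thesis using dD(1) by (auto simp: C_def)
    next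
      case 2
      have "d i (\<pi> x) = d i x" if "x \<in> carrier (P (Suc i))" for x
      proof (rule collapse)
        show "d i \<in> mod_hom (P k) (P i)" using d[of i] 2 by simp
        show "d i (d k y) = \<zero>\<^bsub>P i\<^esub>" if "y \<in> carrier (P (Suc k))" for y
          using exact[of i] that 2 by (auto simp: a_kernel_def')
      qed (use that 2 mods in simp_all)
      then have "d i ` carrier (P (Suc i)) \<subseteq> d i ` C (Suc i)"
        using \<pi>_C 2 by (metis image_eqI image_subsetI)
      moreover have "C i = carrier (P i)" using 2 by (simp add: C_def)
      ultimately show ?thesis using dD(1) C_sub by blast
    next
      case 3
      then show ?thesis
        using r(2) d_zero mod_hom_zero[OF mods mods r(1)]
        by (auto simp: C_def intro!: image_eqI[of _ _ "\<zero>\<^bsub>P (Suc k)\<^esub>"])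
    next
      case 4
      have "\<zero>\<^bsub>P (Suc i)\<^esub> \<in> carrier (P (Suc i))"
        using C_sub[of "Suc i"] 4 by (simp add: C_def)
      then show ?thesis using 4 d_zero[of i] by (force simp: C_def)
    qed
  qed
  moreover have "a_kernel (P' 0) N e = d 0 ` C 1"
  proof -
    have "a_kernel (P' 0) N e = C 0 \<inter> a_kernel (P 0) N e"
      using C_sub[of 0] by (auto simp: a_kernel_def' P'_def)
    then show ?thesis using ker[of 0] e(3) by simp
  qed
  moreover have "a_kernel (P' (Suc i)) (P' i) (d i) = d (Suc i) ` C (Suc (Suc i))" for i
  proof -
    have "a_kernel (P' (Suc i)) (P' i) (d i) = C (Suc i) \<inter> a_kernel (P (Suc i)) (P i) (d i)"
      using C_sub[of "Suc i"] by (auto simp: a_kernel_def' P'_def)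
    then show ?thesis using ker[of "Suc i"] exact[of i] by simp
  qed
  ultimately show ?thesis
    unfolding has_resolution_def
    by (intro exI[of _ P'] exI[of _ d] exI[of _ e]) (simp add: P'_module, simp add: P'_def)
qed

section \<open>Descent to the Gorenstein dimension\<close>

lemma has_resolution_mono:
  "has_resolution C N n \<Longrightarrow> n \<le> m \<Longrightarrow> has_resolution C N m"
  unfolding has_resolution_def by (meson le_less_trans)

lemma has_resolution_descend:
  assumes P: "has_resolution (projective :: ('g::group_add \<Rightarrow>\<^sub>0 rat, 'm) module \<Rightarrow> bool)
      (trivial_module :: ('g \<Rightarrow>\<^sub>0 rat, rat) module) (Suc k)"
    and M: "has_resolution (Gorenstein_projective :: ('g \<Rightarrow>\<^sub>0 int, 'n) module \<Rightarrow> bool)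
      (trivial_module :: ('g \<Rightarrow>\<^sub>0 int, int) module) m"
    and k: "m \<le> k"
  shows "has_resolution (projective :: ('g \<Rightarrow>\<^sub>0 rat, 'm) module \<Rightarrow> bool)
      (trivial_module :: ('g \<Rightarrow>\<^sub>0 rat, rat) module) k"
proof -
  let ?N = "trivial_module :: ('g \<Rightarrow>\<^sub>0 rat, rat) module"
  obtain R d e where R: "\<forall>i. left_module (R i) \<and> projective (R i :: ('g \<Rightarrow>\<^sub>0 rat, 'm) module)"
      "\<forall>i>Suc k. carrier (R i) = {\<zero>\<^bsub>R i\<^esub>}" "\<forall>i. d i \<in> mod_hom (R (Suc i)) (R i)"
      "e \<in> mod_hom (R 0) ?N" "e ` carrier (R 0) = carrier ?N" "a_kernel (R 0) ?N e = d 0 ` carrier (R 1)"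
      "\<forall>i. a_kernel (R (Suc i)) (R i) (d i) = d (Suc i) ` carrier (R (Suc (Suc i)))"
    using P unfolding has_resolution_def by (elim exE conjE) (rule that; assumption)
  have R': "\<And>i. projective (R i)" "\<And>i. i > Suc k \<Longrightarrow> carrier (R i) = {\<zero>\<^bsub>R i\<^esub>}"
      "\<And>i. d i \<in> mod_hom (R (Suc i)) (R i)"
      "\<And>i. a_kernel (R (Suc i)) (R i) (d i) = d (Suc i) ` carrier (R (Suc (Suc i)))"
    using R(1,2,3,7) by simp_all
  obtain r where "r \<in> mod_hom (R k) (R (Suc k))" "\<And>x. x \<in> carrier (R (Suc k)) \<Longrightarrow> r (d k x) = x"
    using resolution_splits[of R d k m, OF R'(1,3,4,2) M k] by blast
  then show ?thesis
    by (intro has_resolution_shorten[of R _ k d e, OF R'(1) left_module_trivial R'(2,3) R(4-6) R'(4)])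
qed

theorem mainTheorem8:
  assumes "cd_Q TYPE('g::group_add) TYPE('m) < \<infinity>"
  shows "cd_Q TYPE('g) TYPE('m) \<le> Gcd_Z TYPE('g) TYPE('n)"
proof -
  let ?R = "has_resolution (projective :: ('g \<Rightarrow>\<^sub>0 rat, 'm) module \<Rightarrow> bool)
      (trivial_module :: ('g \<Rightarrow>\<^sub>0 rat, rat) module)"
  obtain n where n: "?R n"
    using assms by (force simp: cd_Q_def resolution_dim_def Inf_enat_def split: if_splits)
  have "?R m" if m: "has_resolution (Gorenstein_projective :: ('g \<Rightarrow>\<^sub>0 int, 'n) module \<Rightarrow> bool)
      (trivial_module :: ('g \<Rightarrow>\<^sub>0 int, int) module) m" for m
  proof (cases "m \<le> n")
    case True
    then show ?thesis
    \<comment> \<open>Downward induction from \<open>n\<close>: as long as the length is above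
      \<open>m\<close>, the resolution can be shortened by one.\<close>
    proof (induction rule: inc_induct)
      case base
      show ?case by (rule n)
    next
      case (step k)
      show ?case by (rule has_resolution_descend[OF step.IH m step.hyps(1)])
    qed
  next
    case False
    with n show ?thesis by (intro has_resolution_mono[OF n]) simp
  qed
  then show ?thesis
    \<comment> \<open>Every length of a Gorenstein projective resolution is thus a length of a
      projective one, so the infimum on the left is over a larger set.\<close>
    unfolding cd_Q_def Gcd_Z_def resolution_dim_def by (intro Inf_superset_mono image_mono) blast
qed

end
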